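(* Not every biconnected outer-$1$-plane graph of maximum degree $4$ admits an $\mathrm{OC}_2$-layout; that is, there exists a biconnected outer-$1$-plane graph of maximum degree $4$ that has no $\mathrm{OC}_2$-layout respecting its given embedding.
   Context: Graphs are finite and simple. A drawing maps vertices to distinct points of $\mathbb{R}^2$ and edges to curves joining the points of their endpoints; edges do not pass through other vertices, and edges with a common endpoint do not cross. A drawing is $1$-planar if each edge is crossed at most once, and outer-$1$-planar if in addition every vertex lies on the outer (unbounded) face. An outer-$1$-plane graph is a graph together with an outer-$1$-planar embedding, i.e. an outer-$1$-planar drawing in the plane considered up to its combinatorial structure: the cyclic order of the edges around each vertex, which edges cross and in which order, and the outer face. A layout of an outer-$1$-plane graph is always required to respect (realize) the given embedding. An orthogonal layout is a drawing in which each edge is drawn as a sequence of vertical and horizontal line segments, two consecutive segments of an edge meeting in a bend (a $90^\circ$ turn). Every vertex has four ports (North, South, East, West), each edge enters and leaves its end vertices at ports with a horizontal or vertical tangent, and no two edges incident to the same vertex use the same port. The curve complexity of a drawing is the maximum number of segments used for an edge. An $\mathrm{OC}_k$-layout is an orthogonal layout with curve complexity at most $k$, i.e. with at most $k-1$ bends per edge. "Maximum degree $4$" means every vertex has degree at most $4$. *)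

theory Defs
  imports "HOL-Analysis.Analysis" "Graph_Theory.Pair_Digraph" "Graph_Theory.Digraph_Component"
begin

text \<open>
  A finite simple graph is a \<open>pair_graph\<close>: an edge uv is represented by the two arcs (u, v) and
  (v, u).  The plane is the type \<open>complex\<close>.
\<close>

definition biconnected :: "'v pair_pre_digraph \<Rightarrow> bool" where
  "biconnected G \<longleftrightarrow>
     3 \<le> card (pverts G) \<and>
     Digraph_Component.connected (with_proj G) \<and>
     (\<forall>v\<in>pverts G. Digraph_Component.connected (pre_digraph.del_vert (with_proj G) v))"

definition max_degree_le :: "nat \<Rightarrow> 'v pair_pre_digraph \<Rightarrow> bool" where
  "max_degree_le d G \<longleftrightarrow> (\<forall>v\<in>pverts G. out_degree (with_proj G) v \<le> d)"


section \<open>Cyclic order of curves around a point\<close>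

text \<open>
  The circular order of curves leaving a common point is read off from the points where they first
  meet a small circle about it.  For finitely many arcs that pairwise share only their initial
  point, this order is the same for all sufficiently small radii.
\<close>

definition exit_point :: "(real \<Rightarrow> complex) \<Rightarrow> real \<Rightarrow> complex" where
  "exit_point g r = g (Inf {t \<in> {0..1}. r \<le> dist (g 0) (g t)})"

definition exit_angle :: "(real \<Rightarrow> complex) \<Rightarrow> real \<Rightarrow> real" where
  "exit_angle g r = Arg2pi (exit_point g r - g 0)"

definition cyclic_less :: "real \<Rightarrow> real \<Rightarrow> real \<Rightarrow> bool" where
  "cyclic_less a b c \<longleftrightarrow> a < b \<and> b < c \<or> b < c \<and> c < a \<or> c < a \<and> a < b"

text \<open>Curves g, h, k from a common point leave it in this counterclockwise circular order.\<close>

definition ccw :: "(real \<Rightarrow> complex) \<Rightarrow> (real \<Rightarrow> complex) \<Rightarrow> (real \<Rightarrow> complex) \<Rightarrow> bool" where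
  "ccw g h k \<longleftrightarrow>
     (\<forall>\<^sub>F r in at_right 0. cyclic_less (exit_angle g r) (exit_angle h r) (exit_angle k r))"

text \<open>
  The curve h crosses g transversally from right to left at g s = h t: counterclockwise around that
  point one meets g forwards, h forwards, g backwards, h backwards.  Consequently a crossing from
  left to right is \<open>crosses_at h t g s\<close>.
\<close>

definition crosses_at ::
  "(real \<Rightarrow> complex) \<Rightarrow> real \<Rightarrow> (real \<Rightarrow> complex) \<Rightarrow> real \<Rightarrow> bool" where
  "crosses_at g s h t \<longleftrightarrow>
     s \<in> {0<..<1} \<and> t \<in> {0<..<1} \<and> g s = h t \<and>
     ccw (subpath s 1 g) (subpath t 1 h) (subpath s 0 g) \<and>
     ccw (subpath s 0 g) (subpath t 0 h) (subpath s 1 g)"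


section \<open>Drawings\<close>

record 'v drawing =
  pos :: "'v \<Rightarrow> complex"
  curve :: "'v \<times> 'v \<Rightarrow> real \<Rightarrow> complex"

text \<open>
  Edges without a common endpoint meet only in proper crossings; tangential contacts and overlaps
  are excluded.
\<close>

definition is_drawing :: "'v pair_pre_digraph \<Rightarrow> 'v drawing \<Rightarrow> bool" where
  "is_drawing G D \<longleftrightarrow>
     inj_on (pos D) (pverts G) \<and>
     (\<forall>(u, v)\<in>parcs G.
        arc (curve D (u, v)) \<and>
        pathstart (curve D (u, v)) = pos D u \<and> pathfinish (curve D (u, v)) = pos D v \<and>
        curve D (v, u) = reversepath (curve D (u, v)) \<and>
        (\<forall>w\<in>pverts G. pos D w \<in> path_image (curve D (u, v)) \<longrightarrow> w = u \<or> w = v)) \<and>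
     (\<forall>u v w. (u, v) \<in> parcs G \<and> (u, w) \<in> parcs G \<and> v \<noteq> w \<longrightarrow>
        path_image (curve D (u, v)) \<inter> path_image (curve D (u, w)) = {pos D u}) \<and>
     (\<forall>e\<in>parcs G. \<forall>f\<in>parcs G. {fst e, snd e} \<inter> {fst f, snd f} = {} \<longrightarrow>
        (\<forall>s\<in>{0..1}. \<forall>t\<in>{0..1}. curve D e s = curve D f t \<longrightarrow>
           crosses_at (curve D e) s (curve D f) t \<or> crosses_at (curve D f) t (curve D e) s))"

definition one_planar :: "'v pair_pre_digraph \<Rightarrow> 'v drawing \<Rightarrow> bool" where
  "one_planar G D \<longleftrightarrow>
     is_drawing G D \<and>
     (\<forall>e\<in>parcs G. \<forall>f\<in>parcs G. \<forall>f'\<in>parcs G. \<forall>s\<in>{0<..<1}. \<forall>s'\<in>{0<..<1}.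
        f \<notin> {e, prod.swap e} \<and> f' \<notin> {e, prod.swap e} \<and>
        curve D e s \<in> path_image (curve D f) \<and> curve D e s' \<in> path_image (curve D f') \<longrightarrow>
        s = s' \<and> f' \<in> {f, prod.swap f})"

definition skeleton :: "'v pair_pre_digraph \<Rightarrow> 'v drawing \<Rightarrow> complex set" where
  "skeleton G D = pos D ` pverts G \<union> (\<Union>e\<in>parcs G. path_image (curve D e))"

definition outer_face :: "'v pair_pre_digraph \<Rightarrow> 'v drawing \<Rightarrow> complex set" where
  "outer_face G D = outside (skeleton G D)"

definition outer_one_planar :: "'v pair_pre_digraph \<Rightarrow> 'v drawing \<Rightarrow> bool" where
  "outer_one_planar G D \<longleftrightarrow>
     one_planar G D \<and> (\<forall>v\<in>pverts G. pos D v \<in> closure (outer_face G D))"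


section \<open>Embeddings\<close>

definition rotation :: "'v drawing \<Rightarrow> 'v \<Rightarrow> 'v \<Rightarrow> 'v \<Rightarrow> 'v \<Rightarrow> bool" where
  "rotation D v x y z \<longleftrightarrow> ccw (curve D (v, x)) (curve D (v, y)) (curve D (v, z))"

definition crosses :: "'v drawing \<Rightarrow> 'v \<times> 'v \<Rightarrow> 'v \<times> 'v \<Rightarrow> bool" where
  "crosses D e f \<longleftrightarrow> (\<exists>s t. crosses_at (curve D e) s (curve D f) t)"

definition crosses_before ::
  "'v drawing \<Rightarrow> 'v \<times> 'v \<Rightarrow> 'v \<times> 'v \<Rightarrow> 'v \<times> 'v \<Rightarrow> bool" where
  "crosses_before D e f f' \<longleftrightarrow>
     (\<exists>s s' t t'. s < s' \<and> crosses_at (curve D e) s (curve D f) t \<and>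
                  crosses_at (curve D e) s' (curve D f') t')"

text \<open>
  The outer face reaches v inside the sector that extends counterclockwise from the edge vx to the
  edge vy.  For consecutive edges this says that their angle at v belongs to the outer face.
\<close>

definition outer_between ::
  "'v pair_pre_digraph \<Rightarrow> 'v drawing \<Rightarrow> 'v \<Rightarrow> 'v \<Rightarrow> 'v \<Rightarrow> bool" where
  "outer_between G D v x y \<longleftrightarrow>
     (\<exists>h. arc h \<and> pathstart h = pos D v \<and> h ` {0<..1} \<subseteq> outer_face G D \<and>
          ccw (curve D (v, x)) h (curve D (v, y)))"

text \<open>
  Two drawings have the same embedding if they agree in the rotation at every vertex, in the
  crossings and their order along every edge, and in the outer face.  As \<open>crosses\<close> is directed, this
  includes the rotation at each crossing, i.e. at the dummy vertices of the planarization.  On a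
  1-planar drawing \<open>crosses_before\<close> never holds, so agreement forces the other drawing to be
  1-planar as well.
\<close>

definition same_embedding ::
  "'v pair_pre_digraph \<Rightarrow> 'v drawing \<Rightarrow> 'v drawing \<Rightarrow> bool" where
  "same_embedding G D L \<longleftrightarrow>
     (\<forall>v x y z. (v, x) \<in> parcs G \<and> (v, y) \<in> parcs G \<and> (v, z) \<in> parcs G \<longrightarrow>
        (rotation D v x y z \<longleftrightarrow> rotation L v x y z)) \<and>
     (\<forall>e\<in>parcs G. \<forall>f\<in>parcs G. crosses D e f \<longleftrightarrow> crosses L e f) \<and>
     (\<forall>e\<in>parcs G. \<forall>f\<in>parcs G. \<forall>f'\<in>parcs G.
        crosses_before D e f f' \<longleftrightarrow> crosses_before L e f f') \<and>
     (\<forall>v x y. (v, x) \<in> parcs G \<and> (v, y) \<in> parcs G \<longrightarrow>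
        (outer_between G D v x y \<longleftrightarrow> outer_between G L v x y))"


section \<open>Orthogonal layouts\<close>

definition horizontal :: "complex \<Rightarrow> complex \<Rightarrow> bool" where
  "horizontal p q \<longleftrightarrow> Im p = Im q \<and> p \<noteq> q"

definition vertical :: "complex \<Rightarrow> complex \<Rightarrow> bool" where
  "vertical p q \<longleftrightarrow> Re p = Re q \<and> p \<noteq> q"

text \<open>
  The curve g consists of exactly k axis-parallel segments, consecutive ones being perpendicular;
  the parameters \<open>\<tau> 1, \<dots>, \<tau> (k - 1)\<close> are those of its bends.
\<close>

definition orthogonal_curve :: "nat \<Rightarrow> (real \<Rightarrow> complex) \<Rightarrow> bool" where
  "orthogonal_curve k g \<longleftrightarrow>
     (\<exists>\<tau> :: nat \<Rightarrow> real.
        \<tau> 0 = 0 \<and> \<tau> k = 1 \<and>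
        (\<forall>i<k. \<tau> i < \<tau> (Suc i) \<and>
           g ` {\<tau> i..\<tau> (Suc i)} = closed_segment (g (\<tau> i)) (g (\<tau> (Suc i))) \<and>
           (horizontal (g (\<tau> i)) (g (\<tau> (Suc i))) \<or> vertical (g (\<tau> i)) (g (\<tau> (Suc i))))) \<and>
        (\<forall>i. Suc i < k \<longrightarrow>
           (horizontal (g (\<tau> i)) (g (\<tau> (Suc i))) \<longleftrightarrow>
            vertical (g (\<tau> (Suc i))) (g (\<tau> (Suc (Suc i)))))))"

datatype port = North | South | East | West

primrec port_dir :: "port \<Rightarrow> complex" where
  "port_dir North = \<i>"
| "port_dir South = - \<i>"
| "port_dir East = 1"
| "port_dir West = - 1"

definition leaves_via :: "(real \<Rightarrow> complex) \<Rightarrow> port \<Rightarrow> bool" where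
  "leaves_via g d \<longleftrightarrow>
     (\<exists>t\<in>{0<..1}. \<exists>r>0. g ` {0..t} = closed_segment (g 0) (g 0 + of_real r * port_dir d))"

definition orthogonal_layout :: "'v pair_pre_digraph \<Rightarrow> 'v drawing \<Rightarrow> bool" where
  "orthogonal_layout G L \<longleftrightarrow>
     is_drawing G L \<and>
     (\<forall>e\<in>parcs G. \<exists>k. orthogonal_curve k (curve L e)) \<and>
     (\<exists>port_of :: 'v \<Rightarrow> 'v \<Rightarrow> port.
        (\<forall>(u, v)\<in>parcs G. leaves_via (curve L (u, v)) (port_of u v)) \<and>
        (\<forall>u\<in>pverts G. inj_on (port_of u) {v. (u, v) \<in> parcs G}))"

definition OC_layout :: "nat \<Rightarrow> 'v pair_pre_digraph \<Rightarrow> 'v drawing \<Rightarrow> bool" where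
  "OC_layout k G L \<longleftrightarrow>
     orthogonal_layout G L \<and> (\<forall>e\<in>parcs G. \<exists>j\<le>k. orthogonal_curve j (curve L e))"

end

theory Submission
  imports Defs
begin

text \<open>
  The graph consists of three consecutive unit squares, the outer two being complete graphs on four
  vertices, while the middle one consists of its two vertical sides and its two diagonals.  In an
  orthogonal layout with at most one bend per edge, every triangular face has total turning 4 in
  units of 90 degrees.  Adding up the four triangles at the crossing of an outer square shows that
  each side of this square, in particular the one shared with the middle square, bends so as to be
  convex as seen from the outer square.  The triangle that this side bounds in the middle square
  then has a reflex bend and needs both of its half-diagonals bent.  By symmetry the same holds on
  the other side, so each diagonal of the middle square would need two bends.
\<close>

section \<open>Turning of triangular faces\<close>

text \<open>The curves of a layout are arbitrary, so reasoning about faces and their interior angles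
  would lead into the Jordan curve theorem. The argument is therefore kept local. Of each edge it
  records the axis direction at either end and the sign of the bend; these data are linked by the
  rotations at the vertices, by the right angles at the crossings and by the vector equations saying
  that a triangle closes up. The shape of the graph comes from the degree bound. The ends of the two
  shared sides have degree 4, so all four ports are taken there and every angle between consecutive
  edges is exactly one right angle. This leaves no slack in the triangles on either side of a shared
  side. The horizontal sides of the middle square are left out because they would raise these
  degrees to 5. A single outer square only forces a bend on the half of a middle diagonal next to
  it, which one bend per edge still permits; hence the second outer square at the other end.\<close>

definition axial :: "complex \<Rightarrow> bool" where
  "axial d \<longleftrightarrow> d \<in> {1, \<i>, -1, -\<i>}"

text \<open>
  The route from p to q leaves in direction d and has a left bend if t = 1, a right bend if t = -1;
  if t = 0 it is straight and the bend is an arbitrary inner point.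
\<close>

definition route :: "complex \<Rightarrow> complex \<Rightarrow> int \<Rightarrow> complex \<Rightarrow> bool" where
  "route p d t q \<longleftrightarrow>
     (\<exists>l>0. \<exists>m>0. q = p + of_real l * d + of_real m * (d * \<i> powi t))"

definition arrives :: "complex \<Rightarrow> complex \<Rightarrow> int \<Rightarrow> complex \<Rightarrow> complex \<Rightarrow> bool" where
  "arrives p d t q e \<longleftrightarrow> t \<in> {-1,0,1} \<and> route p d t q \<and> d * \<i> powi t = e"

lemma i_powi_simps [simp]:
  "\<i> powi (-1) = -\<i>" "\<i> powi 0 = 1" "\<i> powi 1 = \<i>" "\<i> powi 2 = -1" "\<i> powi 3 = -\<i>" 
  by (simp_all add: power_int_minus power3_eq_cube)

text \<open>
  The corners p, q, x are in counterclockwise order; the interior angles at p and q are kp and kq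
  right angles, the one at x is one.  The conclusion says that the turns add up to 4, i.e.
  (2 - kp) + (2 - kq) + 1 + t1 + t2 - t3 = 4.  The sum is a multiple of 4 between -2 and 6, and the
  value 0 is excluded since such a polygon cannot close up, so planarity is not needed.
\<close>

lemma triangle_turning:
  assumes r: "route p d t1 q" "route q e t2 x" "route p f t3 x"
    and d: "d \<noteq> 0" and t: "t1 \<in> {-1,0,1}" "t2 \<in> {-1,0,1}" "t3 \<in> {-1,0,1}"
    and k: "kq \<in> {1,2}" "kp \<in> {1,2}"
    and e: "- (d * \<i> powi t1) = e * \<i> powi kq" and f: "f = d * \<i> powi kp"
    and x: "e * \<i> powi t2 = \<i> * (f * \<i> powi t3)"
  shows "t1 + t2 - t3 = kp + kq - 1"
proof -
  obtain l1 m1 where 1: "l1 > 0" "m1 > 0" "q = p + of_real l1 * d + of_real m1 * (d * \<i> powi t1)"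
    using r(1) unfolding route_def by blast
  obtain l2 m2 where 2: "l2 > 0" "m2 > 0" "x = q + of_real l2 * e + of_real m2 * (e * \<i> powi t2)"
    using r(2) unfolding route_def by blast
  obtain l3 m3 where 3: "l3 > 0" "m3 > 0" "x = p + of_real l3 * f + of_real m3 * (f * \<i> powi t3)"
    using r(3) unfolding route_def by blast
  define k' where "k' = \<i> powi (- kq)"
  have kk: "\<i> powi kq * k' = 1"
    by (simp add: k'_def power_int_minus)
  have e': "e = - (d * \<i> powi t1 * k')"
    using arg_cong[OF e, of "\<lambda>z. z * k'"] kk by (simp add: mult.assoc)
  have "d * (of_real l1 + of_real m1 * \<i> powi t1 - \<i> powi t1 * k' * (of_real l2 + of_real m2 * \<i> powi t2))
      = d * (\<i> powi kp * (of_real l3 + of_real m3 * \<i> powi t3))"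
    using 1(3) 2(3) 3(3) unfolding e' f by (simp add: algebra_simps)
  then have A: "of_real l1 + of_real m1 * \<i> powi t1 - \<i> powi t1 * k' * (of_real l2 + of_real m2 * \<i> powi t2)
      = \<i> powi kp * (of_real l3 + of_real m3 * \<i> powi t3)"
    using d by simp
  have "d * (- (\<i> powi t1 * k' * \<i> powi t2)) = d * (\<i> * (\<i> powi kp * \<i> powi t3))"
    using x unfolding e' f by (simp add: algebra_simps)
  then have B: "- (\<i> powi t1 * k' * \<i> powi t2) = \<i> * (\<i> powi kp * \<i> powi t3)"
    using d by (metis mult_left_cancel)
  have C: "kq = 1 \<Longrightarrow> k' = -\<i>" "kq = 2 \<Longrightarrow> k' = -1"
    unfolding k'_def by (simp_all add: power_int_minus)
  \<comment> \<open>Once \<open>d\<close> is cancelled only finitely many exponents remain.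
    \<open>B\<close> fixes the turning sum modulo 4, and the real and imaginary parts of
    \<open>A\<close>, with all lengths positive, exclude the wrong multiples.\<close>
  show ?thesis
    using k t A B 1(1,2) 2(1,2) 3(1,2)
    by (elim insertE emptyE; simp add: C complex_eq_iff)
qed

section \<open>Axis directions and their cyclic order\<close>

lemma axial_nonzero: "axial d \<Longrightarrow> d \<noteq> 0"
  by (auto simp: axial_def)

lemma axial_mult: "axial d \<Longrightarrow> axial (\<i> * d)" "axial d \<Longrightarrow> axial (- d)"
  by (auto simp: axial_def)

lemma axial_times_powi: "axial d \<Longrightarrow> t \<in> {-1,0,1} \<Longrightarrow> axial (d * \<i> powi t)"
  by (auto simp: axial_def)

definition dir_less :: "complex \<Rightarrow> complex \<Rightarrow> complex \<Rightarrow> bool" where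
  "dir_less p q r \<longleftrightarrow> cyclic_less (Arg2pi p) (Arg2pi q) (Arg2pi r)"

lemma Arg2pi_axial: "Arg2pi 1 = 0" "Arg2pi \<i> = pi / 2" "Arg2pi (-1) = pi" "Arg2pi (-\<i>) = 3 * pi / 2"
proof -
  show "Arg2pi 1 = 0" "Arg2pi (-1) = pi"
    using Arg2pi_of_real[of 1] Arg2pi_of_real[of "-1"] by simp_all
  show "Arg2pi \<i> = pi / 2"
  proof (rule Arg2pi_unique[of 1])
    show "complex_of_real 1 * exp (\<i> * complex_of_real (pi / 2)) = \<i>"
      unfolding exp_Euler cos_of_real sin_of_real by simp
  qed auto
  show "Arg2pi (-\<i>) = 3 * pi / 2"
  proof (rule Arg2pi_unique[of 1])
    have "cos (3 * pi / 2) = 0" "sin (3 * pi / 2) = -1"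
      using cos_3over2_pi sin_3over2_pi by (simp_all add: mult.commute)
    then show "complex_of_real 1 * exp (\<i> * complex_of_real (3 * pi / 2)) = - \<i>"
      unfolding exp_Euler cos_of_real sin_of_real by simp
  qed auto
qed

text \<open>Distinct axis directions are at least a quarter turn apart, and the three gaps around
  the point add up to four quarter turns. So no gap exceeds two of them, and the gap from
  \<open>r\<close> back to \<open>p\<close> accounts for \<open>k + k' < 4\<close>.\<close>

lemma dir_less_axial:
  assumes "axial p" "axial q" "axial r" "dir_less p q r"
  shows "\<exists>k\<in>{1,2}. \<exists>k'\<in>{1,2}. q = p * \<i> powi k \<and> r = q * \<i> powi k' \<and> k + k' < 4"
  using assms unfolding axial_def dir_less_def
  by (elim insertE emptyE; simp add: Arg2pi_axial cyclic_less_def)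

text \<open>Four axis directions in cyclic order exhaust the ports, so consecutive ones are a single
  quarter turn apart. This is how degree 4 enters the counting.\<close>

lemma dir_less_axial4:
  assumes "axial p" "axial q" "axial r" "axial s" "dir_less p q r" "dir_less p r s"
  shows "q = p * \<i>" "r = q * \<i>" "s = r * \<i>"
  using assms unfolding axial_def dir_less_def
  by (elim insertE emptyE; simp add: Arg2pi_axial cyclic_less_def)+

text \<open>\<open>P\<close>, \<open>dr\<close> and \<open>tn\<close> are all that the counting sees
  of a layout: positions, the direction at \<open>u\<close> towards \<open>v\<close>, and the sign
  of the bend on the way from \<open>u\<close> to \<open>v\<close>. The direction at
  \<open>v\<close> is the arrival direction reversed.\<close>

definition axial_edge :: "('v \<Rightarrow> complex) \<Rightarrow> ('v \<Rightarrow> 'v \<Rightarrow> complex) \<Rightarrow> ('v \<Rightarrow> 'v \<Rightarrow> int) \<Rightarrow> 'v \<Rightarrow> 'v \<Rightarrow> bool"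
  where
  "axial_edge P dr tn u v \<longleftrightarrow>
     axial (dr u v) \<and> tn u v \<in> {-1,0,1} \<and> route (P u) (dr u v) (tn u v) (P v) \<and>
     dr v u = - (dr u v * \<i> powi tn u v)"

lemma axial_edge_axial: "axial_edge P dr tn u v \<Longrightarrow> axial (dr u v)"
  unfolding axial_edge_def by simp

lemma axial_edge_turn_le: "axial_edge P dr tn u v \<Longrightarrow> tn u v \<le> 1"
  unfolding axial_edge_def by auto

text \<open>Going along the edge and back multiplies the direction by a power of \<open>\<i>\<close>
  that must be 1; the exponent lies between -2 and 2, so it is 0.\<close>

lemma axial_edge_turn_swap:
  assumes "axial_edge P dr tn u v" "axial_edge P dr tn v u"
  shows "tn v u = - tn u v"
proof -
  have t: "tn u v \<in> {-1,0,1}" "tn v u \<in> {-1,0,1}"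
    using assms unfolding axial_edge_def by auto
  have "dr v u \<noteq> 0"
    using assms axial_nonzero unfolding axial_edge_def by blast
  moreover have "dr v u = dr v u * (\<i> powi tn v u * \<i> powi tn u v)"
    using assms unfolding axial_edge_def by (metis minus_mult_left minus_minus mult.assoc)
  ultimately have "\<i> powi tn v u * \<i> powi tn u v = 1"
    by (metis mult_cancel_left2)
  with t show ?thesis
    by (elim insertE emptyE; simp add: complex_eq_iff)
qed

lemma edge_triangle:
  assumes pq: "axial_edge P dr tn p q" and r: "route (P q) e t2 x" "route (P p) f t3 x"
    and t: "t2 \<in> {-1,0,1}" "t3 \<in> {-1,0,1}" and k: "kq \<in> {1,2}" "kp \<in> {1,2}"
    and e: "dr q p = e * \<i> powi kq" and f: "f = dr p q * \<i> powi kp"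
    and x: "e * \<i> powi t2 = \<i> * (f * \<i> powi t3)"
  shows "tn p q + t2 - t3 = kp + kq - 1"
proof -
  have pq': "axial (dr p q)" "tn p q \<in> {-1,0,1}" "route (P p) (dr p q) (tn p q) (P q)"
    "- (dr p q * \<i> powi tn p q) = e * \<i> powi kq"
    using pq e unfolding axial_edge_def by auto
  show ?thesis
    by (rule triangle_turning[OF pq'(3) r axial_nonzero[OF pq'(1)] pq'(2) t k pq'(4) f x])
qed

text \<open>
  The corners of the square are a, a', c, b counterclockwise, ac and a'b cross at x, and bd' and cd
  cross at y beyond the side bc.  In the sum of the turning equations of the four triangles at x
  the bends of the half-diagonals cancel.
\<close>

lemma k4_block:
  assumes edges: "\<forall>(u, v)\<in>{(a, b), (b, a), (a, a'), (a', a), (a', c), (c, a'), (c, b), (b, c),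
        (a, c), (c, a), (a', b), (b, a'), (b, d'), (c, d)}. axial_edge P dr tn u v"
    and crossing: "arrives (P a) (dr a c) ha x \<delta>" "arrives (P c) (dr c a) hc x (- \<delta>)"
      "arrives (P a') (dr a' b) ha' x (\<i> * \<delta>)" "arrives (P b) (dr b a') hb x (- (\<i> * \<delta>))"
    and middle: "arrives (P b) (dr b d') gb y \<epsilon>" "arrives (P c) (dr c d) gc y (\<i> * \<epsilon>)"
    and rot: "dir_less (dr a a') (dr a c) (dr a b)" "dir_less (dr a' c) (dr a' b) (dr a' a)"
      "dir_less (dr b a) (dr b a') (dr b c)" "dir_less (dr b a) (dr b c) (dr b d')"
      "dir_less (dr c d) (dr c b) (dr c a)" "dir_less (dr c d) (dr c a) (dr c a')"
  shows "gb = - 1"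
proof -
  have edge: "axial_edge P dr tn b a" "axial_edge P dr tn a a'" "axial_edge P dr tn a' c"
      "axial_edge P dr tn c b" "axial_edge P dr tn b c"
    using edges by simp_all
  have ax: "axial (dr a b)" "axial (dr b a)" "axial (dr a a')" "axial (dr a' a)" "axial (dr a' c)"
    "axial (dr c a')" "axial (dr c b)" "axial (dr b c)" "axial (dr a c)" "axial (dr c a)"
    "axial (dr a' b)" "axial (dr b a')" "axial (dr b d')" "axial (dr c d)"
    using edges by (simp_all add: axial_edge_axial[of P dr tn])
  note c = crossing[unfolded arrives_def] and m = middle[unfolded arrives_def]
  note t = c[THEN conjunct1] and r = c[THEN conjunct2, THEN conjunct1]
    and dir = c[THEN conjunct2, THEN conjunct2]
  note tm = m[THEN conjunct1] and rm = m[THEN conjunct2, THEN conjunct1]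
    and dm = m[THEN conjunct2, THEN conjunct2]
  obtain k1 k2 where k1: "k1 \<in> {1,2}" and k2: "k2 \<in> {1,2}"
    and rot_a: "dr a c = dr a a' * \<i> powi k1" "dr a b = dr a c * \<i> powi k2"
    using dir_less_axial[OF ax(3,9,1) rot(1)] by blast
  obtain k3 k4 where k3: "k3 \<in> {1,2}" and k4: "k4 \<in> {1,2}"
    and rot_a': "dr a' b = dr a' c * \<i> powi k3" "dr a' a = dr a' b * \<i> powi k4"
    using dir_less_axial[OF ax(5,11,4) rot(2)] by blast
  \<comment> \<open>At \<open>a\<close> and \<open>a'\<close> the angles may be one or two right
    angles, whence \<open>k1\<close> to \<open>k4\<close>; at \<open>b\<close> and \<open>c\<close>
    all four directions are known to be present, and every angle is one right angle.\<close>
  note rot_b = dir_less_axial4[OF ax(2,12,8,13) rot(3,4)]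
    and rot_c = dir_less_axial4[OF ax(14,7,10,6) rot(5,6)]
  have one: "1 \<in> {1, 2::int}" by simp
  note i1 = i_powi_simps(3)
  \<comment> \<open>In each of the five triangles the two half-edges reach the crossing a quarter
    turn apart.\<close>
  have x_ba: "dr a c * \<i> powi ha = \<i> * (dr b a' * \<i> powi hb)"
    and x_aa': "dr a' b * \<i> powi ha' = \<i> * (dr a c * \<i> powi ha)"
    and x_a'c: "dr c a * \<i> powi hc = \<i> * (dr a' b * \<i> powi ha')"
    and x_cb: "dr b a' * \<i> powi hb = \<i> * (dr c a * \<i> powi hc)"
    and x_bc: "dr c d * \<i> powi gc = \<i> * (dr b d' * \<i> powi gb)"
    unfolding dir dm by simp_all
  have ba: "tn b a + ha - hb = 1 + k2 - 1"
    by (rule edge_triangle[OF edge(1) r(1,4) t(1,4) k2 one rot_a(2) _ x_ba])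
      (simp only: i1 rot_b(1))
  have aa': "tn a a' + ha' - ha = k1 + k4 - 1"
    by (rule edge_triangle[OF edge(2) r(3,1) t(3,1) k4 k1 rot_a'(2) rot_a(1) x_aa'])
  have a'c: "tn a' c + hc - ha' = k3 + 1 - 1"
    by (rule edge_triangle[OF edge(3) r(2,3) t(2,3) one k3 _ rot_a'(1) x_a'c])
      (simp only: i1 rot_c(3))
  have cb: "tn c b + hb - hc = 1 + 1 - 1"
    by (rule edge_triangle[OF edge(4) r(4,2) t(4,2) one one _ _ x_cb])
      (simp_all only: i1 rot_b(2) rot_c(2))
  have bc: "tn b c + gc - gb = 1 + 1 - 1"
    by (rule edge_triangle[OF edge(5) rm(2,1) tm(2,1) one one _ _ x_bc])
      (simp_all only: i1 rot_b(3) rot_c(1))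
  have "tn c b = - tn b c"
    by (rule axial_edge_turn_swap[OF edge(5,4)])
  moreover have "tn b a \<le> 1" "tn a a' \<le> 1" "tn a' c \<le> 1" "tn c b \<le> 1"
    by (fact edge(1-4)[THEN axial_edge_turn_le])+
  moreover have "gc \<le> 1" "- 1 \<le> gb"
    using tm by auto
  moreover have "k1 \<ge> 1" "k2 \<ge> 1" "k3 \<ge> 1" "k4 \<ge> 1"
    using k1 k2 k3 k4 by auto
  \<comment> \<open>The four turns along the square add up to \<open>k1 + k2 + k3 + k4\<close>, at
    least 4, while each is at most 1; so \<open>tn c b = 1\<close>. Then \<open>bc\<close> reads
    \<open>gc - gb = 2\<close>, which leaves only \<open>gc = 1\<close> and
    \<open>gb = -1\<close>.\<close>
  ultimately show ?thesis using ba aa' a'c cb bc by linarith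
qed

section \<open>Germs of curves\<close>

text \<open>The direction may be any complex number and not only that of a port, so that the
  axis-parallel layout and the straight-line reference drawing share one way of evaluating
  \<open>ccw\<close>.\<close>

definition departs :: "(real \<Rightarrow> complex) \<Rightarrow> complex \<Rightarrow> bool" where
  "departs g d \<longleftrightarrow> (\<exists>t\<in>{0<..1}. \<exists>r>0. g ` {0..t} = closed_segment (g 0) (g 0 + of_real r * d))"

lemma departs_exit_angle:
  assumes g: "path g" and dep: "departs g d" and d: "d \<noteq> 0"
  shows "\<forall>\<^sub>F r in at_right 0. exit_angle g r = Arg2pi d"
proof -
  obtain t R where t: "0 < t" "t \<le> 1" and R: "R > 0"
    and img: "g ` {0..t} = closed_segment (g 0) (g 0 + of_real R * d)"
    using dep unfolding departs_def by auto
  have cont: "continuous_on {0..1} (\<lambda>u. dist (g 0) (g u))"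
    using g unfolding path_def by (intro continuous_intros)
  have "exit_angle g r = Arg2pi d" if r: "0 < r" "r < R * norm d" for r
  proof -
    define S where "S = {u \<in> {0..1}. r \<le> dist (g 0) (g u)}"
    define u0 where "u0 = Inf S"
    \<comment> \<open>Only the image of \<open>{0..t}\<close> is known, not how it is traversed. The
      parameter \<open>u1\<close> of the far end of the segment bounds the first exit
      \<open>u0\<close>, so the exit point lies on the segment.\<close>
    obtain u1 where u1: "u1 \<in> {0..t}" "g u1 = g 0 + of_real R * d"
      using img ends_in_segment(2)[of "g 0 + of_real R * d" "g 0"] by (metis imageE)
    have u1S: "u1 \<in> S"
      using u1 t r R by (auto simp: S_def dist_norm norm_mult)
    have "closed S"
    proof -
      have "S = {0..1} \<inter> (\<lambda>u. dist (g 0) (g u)) -` {r..}"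
        by (auto simp: S_def)
      then show ?thesis
        using continuous_closed_preimage[OF cont closed_atLeastAtMost, of "{r..}"] by simp
    qed
    moreover have bdd: "bdd_below S"
      by (rule bdd_belowI[of _ 0]) (auto simp: S_def)
    ultimately have u0S: "u0 \<in> S"
      unfolding u0_def using u1S by (intro closed_contains_Inf) auto
    have "u0 \<le> u1"
      unfolding u0_def using u1S bdd by (rule cInf_lower)
    with u1 u0S have u0: "u0 \<in> {0..t}" "u0 \<in> {0..1}"
      by (auto simp: S_def)
    have dist_u0: "dist (g 0) (g u0) = r"
    proof -
      have "\<exists>u. 0 \<le> u \<and> u \<le> u0 \<and> dist (g 0) (g u) = r"
        using u0S r u0 continuous_on_subset[OF cont, of "{0..u0}"]
        by (intro IVT') (auto simp: S_def)
      then obtain u where u: "0 \<le> u" "u \<le> u0" "dist (g 0) (g u) = r"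
        by blast
      then have "u \<in> S"
        using u0 by (auto simp: S_def)
      then have "u0 \<le> u"
        unfolding u0_def using bdd by (rule cInf_lower)
      with u show ?thesis by simp
    qed
    have "g u0 \<in> closed_segment (g 0) (g 0 + of_real R * d)"
      using img u0(1) by blast
    then obtain c where c: "0 \<le> c" "g u0 = g 0 + of_real (c * R) * d"
      unfolding closed_segment_image_interval by (auto simp: scaleR_conv_of_real algebra_simps)
    have "c * R > 0"
      using dist_u0 c r R by (cases "c = 0") auto
    then show ?thesis
      unfolding exit_angle_def exit_point_def S_def[symmetric] u0_def[symmetric] c(2)
      using Arg2pi_times_of_real[of "c * R" d] by simp
  qed
  moreover have "R * norm d > 0"
    using R d by simp
  ultimately show ?thesis
    unfolding eventually_at_right_field by blast
qed

lemma ccw_departs: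
  assumes "path g" "path h" "path k" "departs g d" "departs h e" "departs k f"
    and "d \<noteq> 0" "e \<noteq> 0" "f \<noteq> 0"
  shows "ccw g h k \<longleftrightarrow> dir_less d e f"
proof -
  have *: "\<forall>\<^sub>F r in at_right 0. exit_angle g r = Arg2pi d \<and> exit_angle h r = Arg2pi e \<and>
      exit_angle k r = Arg2pi f"
    using assms by (intro eventually_conj departs_exit_angle)
  have "ccw g h k \<longleftrightarrow> (\<forall>\<^sub>F r in at_right (0::real). dir_less d e f)"
    unfolding ccw_def dir_less_def
    by (rule eventually_cong[OF *]) auto
  then show ?thesis by simp
qed

lemma departs_unique:
  assumes "path g" "departs g d" "departs g e" "axial d" "axial e"
  shows "d = e"
proof -
  have "\<forall>\<^sub>F r in at_right (0::real). exit_angle g r = Arg2pi d \<and> exit_angle g r = Arg2pi e"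
    using assms axial_nonzero by (intro eventually_conj departs_exit_angle) auto
  then have "\<forall>\<^sub>F r in at_right (0::real). Arg2pi d = Arg2pi e"
    by eventually_elim simp
  then have "Arg2pi d = Arg2pi e" by simp
  then show ?thesis
    using assms(4,5) unfolding axial_def by (elim insertE emptyE; simp add: Arg2pi_axial)
qed

text \<open>Both signs of \<open>w - s\<close> are covered, so the lemma gives the forward as well
  as the backward germ at an inner point of a curve.\<close>

lemma departs_subpath:
  assumes v: "s < v \<and> v \<le> w \<or> w \<le> v \<and> v < s"
    and img: "g ` closed_segment s v = closed_segment (g s) (g v)"
    and r: "g v = g s + of_real r * d" "r > 0"
  shows "departs (subpath s w g) d"
proof -
  define t where "t = (v - s) / (w - s)"
  have t: "0 < t" "t \<le> 1"
    using v by (auto simp: t_def divide_simps)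
  have "w \<noteq> s" using v by auto
  then have wt: "(w - s) * t + s = v"
    by (simp add: t_def)
  have "(\<lambda>x. (w - s) * x + s) ` {0..t} = closed_segment s v"
    using v t wt by (auto simp: image_affinity_atLeastAtMost closed_segment_eq_real_ivl)
  then have "(subpath s w g) ` {0..t} = closed_segment (g s) (g v)"
    unfolding subpath_def img[symmetric] by (metis image_image)
  then show ?thesis
    unfolding departs_def using t r by (intro bexI[of _ t] exI[of _ r]) (auto simp: subpath_def)
qed

text \<open>A connected subset of a line is convex, so the image of each half contains the segment
  between its ends. The two segments cover the whole one, and by injectivity the two images meet
  only in \<open>g s\<close>, so neither image can be larger than its segment.\<close>

lemma segment_image_split:
  fixes g :: "real \<Rightarrow> complex"
  assumes cont: "continuous_on {u..w} g" and inj: "inj_on g {u..w}" and s: "u \<le> s" "s \<le> w"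
    and img: "g ` {u..w} = closed_segment (g u) (g w)"
  shows "g ` {u..s} = closed_segment (g u) (g s)" "g ` {s..w} = closed_segment (g s) (g w)"
proof -
  let ?A = "g ` {u..s}" and ?B = "g ` {s..w}"
  have cvx: "convex (g ` {x..y})" if "u \<le> x" "y \<le> w" for x y
  proof -
    have "g ` {x..y} \<subseteq> closed_segment (g u) (g w)"
      unfolding img[symmetric] using that by (intro image_mono) auto
    then have "collinear (g ` {x..y})"
      using collinear_closed_segment collinear_subset by blast
    moreover have "Topological_Spaces.connected (g ` {x..y})"
      using that by (intro connected_continuous_image continuous_on_subset[OF cont]) auto
    ultimately show ?thesis
      using convex_connected_collinear by blast
  qed
  have A: "closed_segment (g u) (g s) \<subseteq> ?A"
    using s by (intro closed_segment_subset cvx) auto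
  have B: "closed_segment (g s) (g w) \<subseteq> ?B"
    using s by (intro closed_segment_subset cvx) auto
  have AB: "?A \<inter> ?B \<subseteq> {g s}"
  proof
    fix y assume "y \<in> ?A \<inter> ?B"
    then obtain x x' where x: "x \<in> {u..s}" "x' \<in> {s..w}" "y = g x" "y = g x'"
      by auto
    then have "x = x'"
      using inj s by (intro inj_onD[OF inj]) auto
    with x show "y \<in> {g s}" by auto
  qed
  have U: "closed_segment (g u) (g s) \<union> closed_segment (g s) (g w) = closed_segment (g u) (g w)"
    using s img by (intro Un_closed_segment) (metis atLeastAtMost_iff image_eqI)
  have "?A \<union> ?B = closed_segment (g u) (g w)"
    unfolding img[symmetric] using s by (subst image_Un[symmetric]) (simp add: ivl_disj_un)
  moreover have "g s \<in> closed_segment (g u) (g s)" "g s \<in> closed_segment (g s) (g w)"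
    by auto
  moreover have "A = S \<and> B = T" if "A \<union> B = S \<union> T" "S \<subseteq> A" "T \<subseteq> B" "A \<inter> B \<subseteq> {c}" "c \<in> S" "c \<in> T"
    for A B S T :: "complex set" and c
    using that by blast
  ultimately show "?A = closed_segment (g u) (g s)" "?B = closed_segment (g s) (g w)"
    using U A B AB by metis+
qed

text \<open>The four gaps around the crossing are one or two quarter turns each and their sum is a
  multiple of 4. The two bounds below 4 keep it at most 6, so it is 4 and every gap is a single
  quarter turn.\<close>

lemma dir_less_crossing:
  assumes "axial p" "axial q" "axial r" "axial s" "dir_less p q r" "dir_less r s p"
  shows "r = - p \<and> q = \<i> * p \<and> s = - q"
proof -
  obtain k k' where k: "k \<in> {1,2}" "k' \<in> {1,2}" "q = p * \<i> powi k" "r = q * \<i> powi k'" "k + k' < 4"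
    using dir_less_axial[OF assms(1,2,3,5)] by blast
  obtain l l' where l: "l \<in> {1,2}" "l' \<in> {1,2}" "s = r * \<i> powi l" "p = s * \<i> powi l'" "l + l' < 4"
    using dir_less_axial[OF assms(3,4,1,6)] by blast
  have "p * (\<i> powi k * \<i> powi k' * \<i> powi l * \<i> powi l') = p * 1"
    unfolding mult.assoc[symmetric] k(3)[symmetric] k(4)[symmetric] l(3)[symmetric] l(4)[symmetric]
    by simp
  then have "\<i> powi k * \<i> powi k' * \<i> powi l * \<i> powi l' = 1"
    by (simp only: mult_left_cancel[OF axial_nonzero[OF assms(1)]])
  then have "k = 1 \<and> k' = 1 \<and> l = 1"
    using k(1,2,5) l(1,2,5) by (elim insertE emptyE; simp add: complex_eq_iff)
  then have "q = \<i> * p" "r = \<i> * q" "s = \<i> * r"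
    using k(3,4) l(3) by (simp_all only: i_powi_simps mult.commute)
  then show ?thesis
    by simp
qed

section \<open>Edges with at most one bend\<close>

text \<open>Straight and bent edges share this form with exactly two pieces: \<open>b\<close> is the
  parameter of the bend, and for a straight edge \<open>t = 0\<close> and the bend is
  fictitious.\<close>

definition elbow :: "(real \<Rightarrow> complex) \<Rightarrow> real \<Rightarrow> complex \<Rightarrow> int \<Rightarrow> bool" where
  "elbow g b d t \<longleftrightarrow>
     0 < b \<and> b < 1 \<and> axial d \<and> t \<in> {-1,0,1} \<and>
     (\<exists>l>0. g b = g 0 + of_real l * d) \<and>
     (\<exists>m>0. g 1 = g b + of_real m * (d * \<i> powi t)) \<and>
     g ` {0..b} = closed_segment (g 0) (g b) \<and> g ` {b..1} = closed_segment (g b) (g 1)"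

lemma horizontal_axial:
  assumes "horizontal p q"
  obtains l d where "l > 0" "d \<in> {1,-1}" "q = p + of_real l * d"
proof (cases "Re p < Re q")
  case True
  with assms show thesis
    by (intro that[of "Re q - Re p" 1]) (auto simp: horizontal_def complex_eq_iff)
next
  case False
  with assms show thesis
    by (intro that[of "Re p - Re q" "-1"]) (auto simp: horizontal_def complex_eq_iff)
qed

lemma vertical_axial:
  assumes "vertical p q"
  obtains l d where "l > 0" "d \<in> {\<i>,-\<i>}" "q = p + of_real l * d"
proof (cases "Im p < Im q")
  case True
  with assms show thesis
    by (intro that[of "Im q - Im p" \<i>]) (auto simp: vertical_def complex_eq_iff)
next
  case False
  with assms show thesis
    by (intro that[of "Im p - Im q" "-\<i>"]) (auto simp: vertical_def complex_eq_iff)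
qed

lemma open_segment_point:
  assumes "x \<in> closed_segment p q" "x \<noteq> p" "x \<noteq> q" "q = p + of_real l * d" "l > 0"
  obtains l1 l2 where "l1 > 0" "l2 > 0" "x = p + of_real l1 * d" "q = x + of_real l2 * (d::complex)"
proof -
  have "x \<in> open_segment p q"
    using assms by (simp add: open_segment_def)
  then obtain u where "0 < u" "u < 1" "x = (1 - u) *\<^sub>R p + u *\<^sub>R q"
    unfolding in_segment by blast
  then show thesis
    using assms(4,5)
    by (intro that[of "u * l" "(1 - u) * l"]) (simp_all add: scaleR_conv_of_real algebra_simps)
qed

lemma elbow_exists:
  assumes g: "arc g" and k: "orthogonal_curve k g" "k \<le> 2"
  obtains b d t where "elbow g b d t"
proof -
  obtain \<tau> :: "nat \<Rightarrow> real" where \<tau>: "\<tau> 0 = 0" "\<tau> k = 1"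
    and seg: "\<And>i. i < k \<Longrightarrow> \<tau> i < \<tau> (Suc i) \<and>
           g ` {\<tau> i..\<tau> (Suc i)} = closed_segment (g (\<tau> i)) (g (\<tau> (Suc i))) \<and>
           (horizontal (g (\<tau> i)) (g (\<tau> (Suc i))) \<or> vertical (g (\<tau> i)) (g (\<tau> (Suc i))))"
    and alt: "\<And>i. Suc i < k \<Longrightarrow> horizontal (g (\<tau> i)) (g (\<tau> (Suc i))) \<longleftrightarrow>
            vertical (g (\<tau> (Suc i))) (g (\<tau> (Suc (Suc i))))"
    using k(1) unfolding orthogonal_curve_def by blast
  have "k \<noteq> 0"
    using \<tau> by (metis zero_neq_one)
  then consider "k = 1" | "k = 2"
    using k(2) by linarith
  then show thesis
  proof cases
    case 1
    have img: "g ` {0..1} = closed_segment (g 0) (g 1)"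
      and hv: "horizontal (g 0) (g 1) \<or> vertical (g 0) (g 1)"
      using seg[of 0] \<tau> 1 by simp_all
    obtain l d where l: "l > 0" "axial d" "g 1 = g 0 + of_real l * d"
      using hv horizontal_axial[of "g 0" "g 1"] vertical_axial[of "g 0" "g 1"]
      unfolding axial_def by (smt (verit) insert_iff)
    have inj: "inj_on g {0..1}" and cont: "continuous_on {0..1} g"
      using g by (simp_all add: arc_def path_def)
    \<comment> \<open>The parameter 1/2 serves as the fictitious bend; any inner parameter would
      do.\<close>
    have "g (1/2) \<in> closed_segment (g 0) (g 1)"
      unfolding img[symmetric] by simp
    moreover have "g (1/2) \<noteq> g 0" "g (1/2) \<noteq> g 1"
      using inj_onD[OF inj, of "1/2" 0] inj_onD[OF inj, of "1/2" 1] by auto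
    ultimately obtain l1 l2 where "l1 > 0" "l2 > 0" "g (1/2) = g 0 + of_real l1 * d"
      "g 1 = g (1/2) + of_real l2 * d"
      using l open_segment_point by metis
    moreover have "g ` {0..1/2} = closed_segment (g 0) (g (1/2))"
      "g ` {1/2..1} = closed_segment (g (1/2)) (g 1)"
      using segment_image_split[OF cont inj _ _ img, of "1/2"] by simp_all
    ultimately have "elbow g (1/2) d 0"
      using l(2) unfolding elbow_def by auto
    then show thesis by (rule that)
  next
    case 2
    define b where "b = \<tau> 1"
    have b: "0 < b" "b < 1" "g ` {0..b} = closed_segment (g 0) (g b)"
      "g ` {b..1} = closed_segment (g b) (g 1)"
      using seg[of 0] seg[of 1] \<tau> 2 by (simp_all add: b_def numeral_2_eq_2)
    have hv: "horizontal (g 0) (g b) \<or> vertical (g 0) (g b)"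
      "horizontal (g b) (g 1) \<or> vertical (g b) (g 1)"
      "horizontal (g 0) (g b) \<longleftrightarrow> vertical (g b) (g 1)"
      using seg[of 0] seg[of 1] alt[of 0] \<tau> 2 by (simp_all add: b_def numeral_2_eq_2)
    have "\<exists>d t. elbow g b d t"
    proof (cases "horizontal (g 0) (g b)")
      case True
      then obtain l d where l: "l > 0" "d \<in> {1,-1}" "g b = g 0 + of_real l * d"
        by (rule horizontal_axial)
      obtain m e where m: "m > 0" "e \<in> {\<i>,-\<i>}" "g 1 = g b + of_real m * e"
        using True hv(3) vertical_axial by blast
      have "\<exists>t\<in>{-1,0,1}. e = d * \<i> powi t"
        using l(2) m(2) by auto
      then show ?thesis
        using l m b unfolding elbow_def axial_def by blast
    next
      case False
      then obtain l d where l: "l > 0" "d \<in> {\<i>,-\<i>}" "g b = g 0 + of_real l * d"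
        using hv(1) vertical_axial by blast
      obtain m e where m: "m > 0" "e \<in> {1,-1}" "g 1 = g b + of_real m * e"
        using False hv(2,3) horizontal_axial by blast
      have "\<exists>t\<in>{-1,0,1}. e = d * \<i> powi t"
        using l(2) m(2) by auto
      then show ?thesis
        using l m b unfolding elbow_def axial_def by blast
    qed
    then show thesis using that by blast
  qed
qed

lemma routeI:
  "l > 0 \<Longrightarrow> m > 0 \<Longrightarrow> q = p + of_real l * d + of_real m * (d * \<i> powi t) \<Longrightarrow> route p d t q"
  unfolding route_def by blast

lemma elbow_route: "elbow g b d t \<Longrightarrow> route (g 0) d t (g 1)"
  unfolding elbow_def by (auto simp only: intro: routeI)

lemma elbow_departs:
  assumes "elbow g b d t"
  shows "departs g d"
proof -
  obtain l where "l > 0" "g b = g 0 + of_real l * d"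
    using assms unfolding elbow_def by auto
  then have "departs (subpath 0 1 g) d"
    using assms unfolding elbow_def
    by (intro departs_subpath[of _ b]) (auto simp: closed_segment_eq_real_ivl)
  then show ?thesis by simp
qed

lemma elbow_departs_end:
  assumes "elbow g b d t"
  shows "departs (reversepath g) (- (d * \<i> powi t))"
proof -
  obtain m where m: "m > 0" "g 1 = g b + of_real m * (d * \<i> powi t)"
    using assms unfolding elbow_def by auto
  have "departs (subpath 1 0 g) (- (d * \<i> powi t))"
    using assms m unfolding elbow_def
    by (intro departs_subpath[of _ b _ _ m]) (auto simp: closed_segment_eq_real_ivl closed_segment_commute)
  then show ?thesis by (simp add: subpath_reversepath)
qed

lemma route_straight:
  assumes "l > 0" "q = p + of_real l * d"
  shows "route p d 0 q"
  using assms by (intro routeI[of "l/2" "l/2"]) (simp_all add: algebra_simps flip: distrib_left mult_2)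

text \<open>The edge is cut at parameter \<open>s\<close> and each part is read from its own end
  vertex. The first disjunction expresses that a single bend can lie on only one of the two
  parts.\<close>

definition halves :: "(real \<Rightarrow> complex) \<Rightarrow> real \<Rightarrow> complex \<Rightarrow> complex \<Rightarrow> complex \<Rightarrow> int \<Rightarrow> int \<Rightarrow> bool" where
  "halves g s \<delta> d d' t t' \<longleftrightarrow>
     (t = 0 \<or> t' = 0) \<and> arrives (g 0) d t (g s) \<delta> \<and> arrives (g 1) d' t' (g s) (- \<delta>)"

lemma elbow_interior:
  assumes g: "arc g" and e: "elbow g b d t" and s: "0 < s" "s < 1"
  obtains \<delta> \<delta>' where "axial \<delta>" "axial \<delta>'" "departs (subpath s 1 g) \<delta>" "departs (subpath s 0 g) \<delta>'"
    "\<delta>' = - \<delta> \<Longrightarrow> \<exists>t1 t2. halves g s \<delta> d (- (d * \<i> powi t)) t1 t2"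
proof -
  obtain l m where b: "0 < b" "b < 1" and d: "axial d" and t: "t \<in> {-1,0,1}"
    and l: "l > 0" "g b = g 0 + of_real l * d"
    and m: "m > 0" "g 1 = g b + of_real m * (d * \<i> powi t)"
    and img: "g ` {0..b} = closed_segment (g 0) (g b)" "g ` {b..1} = closed_segment (g b) (g 1)"
    using e unfolding elbow_def by blast
  define d2 where "d2 = d * \<i> powi t"
  have d2: "axial d2"
    unfolding d2_def using d t by (rule axial_times_powi)
  have d_back: "d2 * \<i> powi (- t) = d"
    by (simp add: d2_def power_int_minus)
  have inj: "inj_on g {0..1}" and cont: "continuous_on {0..1} g"
    using g by (simp_all add: arc_def path_def)
  have neq: "g x \<noteq> g y" if "x \<noteq> y" "x \<in> {0..1}" "y \<in> {0..1}" for x y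
    using that inj by (auto dest: inj_onD)
  have sub: "inj_on g {x..y}" "continuous_on {x..y} g" if "0 \<le> x" "y \<le> 1" for x y
    using that inj cont by (auto intro: inj_on_subset continuous_on_subset)
  consider "s < b" | "s = b" | "b < s" by linarith
  then show thesis
  proof cases
    case 1
    have "g s \<in> closed_segment (g 0) (g b)" unfolding img(1)[symmetric] using 1 s by auto
    then obtain l1 l2 where l12: "l1 > 0" "l2 > 0" "g s = g 0 + of_real l1 * d" "g b = g s + of_real l2 * d"
      using open_segment_point[of "g s" "g 0" "g b" l d] l neq[of s 0] neq[of s b] 1 s b by auto
    have split: "g ` {0..s} = closed_segment (g 0) (g s)" "g ` {s..b} = closed_segment (g s) (g b)"
      using segment_image_split[OF sub(2,1)[of 0 b] _ _ img(1), of s] 1 s b by auto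
    show thesis
    proof (rule that[of d "- d"])
      show "departs (subpath s 1 g) d"
        using 1 b l12 split
        by (intro departs_subpath[of _ b _ _ l2]) (auto simp: closed_segment_eq_real_ivl)
      show "departs (subpath s 0 g) (- d)"
        using 1 s l12 split
        by (intro departs_subpath[of _ 0 _ _ l1]) (auto simp: closed_segment_eq_real_ivl closed_segment_commute)
      \<comment> \<open>The bend lies on the second half. That half is read backwards from
        \<open>g 1\<close>, which reverses the sign of the bend.\<close>
      have "route (g 1) (- d2) (- t) (g s)"
        using m l12 d_back by (intro routeI[of m l2]) (simp_all add: d2_def[symmetric])
      then have "halves g s d d (- (d * \<i> powi t)) 0 (- t)"
        using t l12 route_straight d_back by (auto simp: halves_def arrives_def d2_def[symmetric])
      then show "\<exists>t1 t2. halves g s d d (- (d * \<i> powi t)) t1 t2" by blast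
    qed (use d axial_mult in auto)
  next
    case 2
    show thesis
    proof (rule that[of d2 "- d"])
      show "departs (subpath s 1 g) d2"
        using 2 b m img
        by (intro departs_subpath[of _ 1 _ _ m]) (auto simp: closed_segment_eq_real_ivl d2_def)
      show "departs (subpath s 0 g) (- d)"
        using 2 b l img
        by (intro departs_subpath[of _ 0 _ _ l]) (auto simp: closed_segment_eq_real_ivl closed_segment_commute)
      \<comment> \<open>At the bend parameter the two germs are opposite only if the curve does not
        turn there; then both halves are straight.\<close>
      assume "- d = - d2"
      then have "d2 = d" by simp
      moreover have "route (g 1) (- d) 0 (g s)" if "d2 = d"
        using m that 2 by (intro route_straight[of m]) (auto simp: d2_def[symmetric])
      moreover have "route (g 0) d 0 (g s)"
        using l 2 by (intro route_straight[of l]) auto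
      ultimately have "halves g s d2 d (- (d * \<i> powi t)) 0 0"
        by (simp add: halves_def arrives_def flip: d2_def)
      then show "\<exists>t1 t2. halves g s d2 d (- (d * \<i> powi t)) t1 t2" by blast
    qed (use d d2 axial_mult in auto)
  next
    case 3
    have "g s \<in> closed_segment (g b) (g 1)" unfolding img(2)[symmetric] using 3 s by auto
    then obtain m1 m2 where m12: "m1 > 0" "m2 > 0" "g s = g b + of_real m1 * d2" "g 1 = g s + of_real m2 * d2"
      using open_segment_point[of "g s" "g b" "g 1" m d2] m neq[of s 1] neq[of s b] 3 s b
      by (auto simp: d2_def)
    have split: "g ` {b..s} = closed_segment (g b) (g s)" "g ` {s..1} = closed_segment (g s) (g 1)"
      using segment_image_split[OF sub(2,1)[of b 1] _ _ img(2), of s] 3 s b by auto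
    show thesis
    proof (rule that[of d2 "- d2"])
      show "departs (subpath s 1 g) d2"
        using 3 s m12 split
        by (intro departs_subpath[of _ 1 _ _ m2]) (auto simp: closed_segment_eq_real_ivl)
      show "departs (subpath s 0 g) (- d2)"
        using 3 b m12 split
        by (intro departs_subpath[of _ b _ _ m1]) (auto simp: closed_segment_eq_real_ivl closed_segment_commute)
      have "route (g 0) d t (g s)"
        using l m12 by (intro routeI[of l m1]) (simp_all add: d2_def)
      moreover have "route (g 1) (- d2) 0 (g s)"
        using m12 by (intro route_straight[of m2]) auto
      ultimately have "halves g s d2 d (- (d * \<i> powi t)) t 0"
        using t by (simp add: halves_def arrives_def flip: d2_def)
      then show "\<exists>t1 t2. halves g s d2 d (- (d * \<i> powi t)) t1 t2" by blast
    qed (use d2 axial_mult in auto)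
  qed
qed

text \<open>The two cyclic orders at a transversal crossing force its four axis directions into a
  right-angled cross. Hence each curve runs straight through the crossing, and its bend, if any,
  lies on one of its halves.\<close>

lemma crossing_halves:
  assumes g: "arc g" "elbow g b d t" and h: "arc h" "elbow h b' e t'" and x: "crosses_at g s h s'"
  obtains \<delta> t1 t2 t3 t4 where "halves g s \<delta> d (- (d * \<i> powi t)) t1 t2"
    "halves h s' (\<i> * \<delta>) e (- (e * \<i> powi t')) t3 t4"
proof -
  have s: "0 < s" "s < 1" "0 < s'" "s' < 1"
    using x unfolding crosses_at_def by auto
  have c: "ccw (subpath s 1 g) (subpath s' 1 h) (subpath s 0 g)"
     "ccw (subpath s 0 g) (subpath s' 0 h) (subpath s 1 g)"
    using x unfolding crosses_at_def by auto
  obtain \<delta> \<delta>' where \<delta>: "axial \<delta>" "axial \<delta>'" "departs (subpath s 1 g) \<delta>" "departs (subpath s 0 g) \<delta>'"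
    "\<delta>' = - \<delta> \<Longrightarrow> \<exists>t1 t2. halves g s \<delta> d (- (d * \<i> powi t)) t1 t2"
    using elbow_interior[OF g s(1,2)] by blast
  obtain \<epsilon> \<epsilon>' where \<epsilon>: "axial \<epsilon>" "axial \<epsilon>'" "departs (subpath s' 1 h) \<epsilon>" "departs (subpath s' 0 h) \<epsilon>'"
    "\<epsilon>' = - \<epsilon> \<Longrightarrow> \<exists>t1 t2. halves h s' \<epsilon> e (- (e * \<i> powi t')) t1 t2"
    using elbow_interior[OF h s(3,4)] by blast
  have p: "path (subpath u v g)" "path (subpath u v h)" if "u \<in> {0..1}" "v \<in> {0..1}" for u v
    using that g(1) h(1) arc_imp_path path_subpath by auto
  have "dir_less \<delta> \<epsilon> \<delta>'" "dir_less \<delta>' \<epsilon>' \<delta>"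
    using c \<delta>(1-4) \<epsilon>(1-4) s axial_nonzero ccw_departs p by auto
  then have "\<delta>' = - \<delta> \<and> \<epsilon> = \<i> * \<delta> \<and> \<epsilon>' = - \<epsilon>"
    using dir_less_crossing \<delta>(1,2) \<epsilon>(1,2) by blast
  with \<delta>(5) \<epsilon>(5) show thesis
    using that by blast
qed

section \<open>Straight-line drawings\<close>

text \<open>\<open>Im (cnj p * q)\<close> is the cross product of \<open>p\<close> and
  \<open>q\<close>; its sign turns statements about angles into arithmetic on coordinates.\<close>

lemma Im_cnj_mult_Arg2pi:
  "Im (cnj p * q) = norm p * norm q * sin (Arg2pi q - Arg2pi p)"
proof -
  have *: "z = rcis (norm z) (Arg2pi z)" for z
    using Arg2pi_eq[of z] by (simp add: rcis_def cis_conv_exp)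
  have "cnj p = rcis (norm p) (- Arg2pi p)"
    using arg_cong[OF *[of p], of cnj] by (simp add: rcis_def cis_cnj)
  then have "cnj p * q = rcis (norm p) (- Arg2pi p) * rcis (norm q) (Arg2pi q)"
    using *[of q] by simp
  also have "\<dots> = rcis (norm p * norm q) (Arg2pi q - Arg2pi p)"
    by (simp add: rcis_mult)
  finally show ?thesis by simp
qed

lemma sin_pos_cases:
  assumes "sin x > 0" "- 2 * pi < x" "x < 2 * pi"
  shows "0 < x \<and> x < pi \<or> - 2 * pi < x \<and> x < - pi"
proof (rule ccontr)
  assume "\<not> ?thesis"
  with assms(2,3) consider "pi \<le> x" | "- pi \<le> x" "x \<le> 0"
    by linarith
  then show False
  proof cases
    case 1
    then have "sin (x - pi) \<ge> 0" using assms by (intro sin_ge_zero) auto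
    then show False using assms by (simp add: sin_diff)
  next
    case 2
    then have "sin (- x) \<ge> 0" by (intro sin_ge_zero) auto
    then show False using assms by simp
  qed
qed

text \<open>A positive cross product is a counterclockwise step of less than \<open>pi\<close>, so
  two such steps together stay below a full turn.\<close>

lemma dir_less_cross:
  assumes "Im (cnj p * q) > 0" "Im (cnj q * r) > 0"
  shows "dir_less p q r"
proof -
  have *: "0 < Arg2pi b - Arg2pi a \<and> Arg2pi b - Arg2pi a < pi \<or>
      - 2 * pi < Arg2pi b - Arg2pi a \<and> Arg2pi b - Arg2pi a < - pi" if "Im (cnj a * b) > 0" for a b
  proof (rule sin_pos_cases)
    show "sin (Arg2pi b - Arg2pi a) > 0"
      using that unfolding Im_cnj_mult_Arg2pi
      by (auto simp: zero_less_mult_iff mult_less_0_iff)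
  qed (use Arg2pi[of a] Arg2pi[of b] in linarith)+
  show ?thesis
    using *[OF assms(1)] *[OF assms(2)] Arg2pi[of p] Arg2pi[of q] Arg2pi[of r]
    unfolding dir_less_def cyclic_less_def by linarith
qed

lemma linepath_image_segment:
  "linepath p q ` closed_segment s v = closed_segment (linepath p q s) (linepath p q v)"
proof -
  have l: "linear (\<lambda>x. x *\<^sub>R (q - p))"
    by (simp add: linear_iff algebra_simps)
  have *: "linepath p q = (+) p \<circ> (\<lambda>x. x *\<^sub>R (q - p))"
    by (simp add: fun_eq_iff linepath_def algebra_simps)
  show ?thesis
    unfolding * image_comp[symmetric] closed_segment_linear_image[OF l, symmetric]
    by (simp add: closed_segment_translation)
qed

lemma departs_linepath:
  assumes "p \<noteq> q" "0 \<le> s" "s \<le> 1"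
  shows "s < 1 \<Longrightarrow> departs (subpath s 1 (linepath p q)) (q - p)"
    and "0 < s \<Longrightarrow> departs (subpath s 0 (linepath p q)) (- (q - p))"
proof -
  assume "s < 1"
  then show "departs (subpath s 1 (linepath p q)) (q - p)"
    using linepath_image_segment[of p q s 1]
    by (intro departs_subpath[of _ 1 _ _ "1 - s"]) (auto simp: linepath_def scaleR_conv_of_real algebra_simps)
next
  assume "0 < s"
  then show "departs (subpath s 0 (linepath p q)) (- (q - p))"
    using linepath_image_segment[of p q s 0]
    by (intro departs_subpath[of _ 0 _ _ s]) (auto simp: linepath_def scaleR_conv_of_real algebra_simps)
qed

lemma departs_linepath_start: "p \<noteq> q \<Longrightarrow> departs (linepath p q) (q - p)"
  using departs_linepath(1)[of p q 0] by simp

lemma crosses_at_linepath: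
  assumes s: "s \<in> {0<..<1}" "t \<in> {0<..<1}" and eq: "linepath p q s = linepath p' q' t"
    and cr: "Im (cnj (q - p) * (q' - p')) > 0"
  shows "crosses_at (linepath p q) s (linepath p' q') t"
proof -
  have ne: "p \<noteq> q" "p' \<noteq> q'" using cr by auto
  have p: "path (subpath u v (linepath a b))" if "u \<in> {0..1}" "v \<in> {0..1}" for u v and a b :: complex
    using that by (intro path_subpath) auto
  note d = departs_linepath[OF ne(1), of s] departs_linepath[OF ne(2), of t]
  have "dir_less (q - p) (q' - p') (- (q - p))"
    using cr by (intro dir_less_cross) (auto simp: algebra_simps)
  moreover have "dir_less (- (q - p)) (- (q' - p')) (q - p)"
    using cr by (intro dir_less_cross) (auto simp: algebra_simps)
  ultimately show ?thesis
    unfolding crosses_at_def using s eq ne d p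
    by (simp add: ccw_departs[of _ _ _ "q - p" "q' - p'" "- (q - p)"]
         ccw_departs[of _ _ _ "- (q - p)" "- (q' - p')" "q - p"])
qed

definition straight_drawing :: "('v \<Rightarrow> complex) \<Rightarrow> 'v drawing" where
  "straight_drawing p = \<lparr>pos = p, curve = (\<lambda>(u, v). linepath (p u) (p v))\<rparr>"

lemma straight_drawing_simps [simp]:
  "pos (straight_drawing p) = p" "curve (straight_drawing p) (u, v) = linepath (p u) (p v)"
  by (simp_all add: straight_drawing_def)

lemma straight_rotation:
  assumes "Im (cnj (p x - p v) * (p y - p v)) > 0" "Im (cnj (p y - p v) * (p z - p v)) > 0"
  shows "rotation (straight_drawing p) v x y z"
proof -
  have ne: "p v \<noteq> p x" "p v \<noteq> p y" "p v \<noteq> p z"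
    using assms by auto
  show ?thesis
    unfolding rotation_def using dir_less_cross[OF assms] ne
    by (simp add: ccw_departs[OF _ _ _ ne[THEN departs_linepath_start]])
qed

text \<open>Measured along \<open>ab\<close>, the points \<open>c\<close> and \<open>d\<close> have
  coordinates \<open>s - t * k\<close> and \<open>s + (1 - t) * k\<close>, with \<open>s\<close>
  strictly between them. If neither lies in the unit interval, they lie on opposite sides of it, and
  then \<open>cd\<close> contains \<open>a\<close>.\<close>

lemma collinear_segments_overlap:
  fixes a b c d :: complex
  assumes st: "s \<in> {0<..<1}" "t \<in> {0<..<1}" and eq: "linepath a b s = linepath c d t"
    and par: "Im (cnj (b - a) * (d - c)) = 0" and ne: "a \<noteq> b" "c \<noteq> d"
  shows "a \<in> closed_segment c d \<or> c \<in> closed_segment a b \<or> d \<in> closed_segment a b"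
proof -
  have st': "0 < s" "s < 1" using st by auto
  define k where "k = Re ((d - c) / (b - a))"
  have "Im ((d - c) / (b - a)) = 0"
    using par by (simp add: Im_divide algebra_simps)
  then have "(d - c) / (b - a) = of_real k"
    by (simp add: k_def complex_eq_iff)
  then have k: "d - c = of_real k * (b - a)"
    using ne by (simp add: divide_eq_eq)
  then have k0: "k \<noteq> 0" using ne by auto
  have eq': "c + of_real t * (d - c) = a + of_real s * (b - a)"
    using eq by (simp add: linepath_def scaleR_conv_of_real algebra_simps)
  have c: "c = a + of_real (s - t * k) * (b - a)"
    using eq' unfolding k by (simp add: algebra_simps)
  have d: "d = a + of_real (s + (1 - t) * k) * (b - a)"
  proof -
    have "d = c + of_real k * (b - a)"
      unfolding k[symmetric] by simp
    also have "\<dots> = a + of_real (s - t * k) * (b - a) + of_real k * (b - a)"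
      by (subst c) simp
    finally show ?thesis by (simp add: algebra_simps)
  qed
  have seg: "x \<in> closed_segment u v" if "0 \<le> r" "r \<le> 1" "x = u + of_real r * (v - u)" for x u v :: complex and r
    using that unfolding in_segment by (intro exI[of _ r]) (auto simp: scaleR_conv_of_real algebra_simps)
  show ?thesis
  proof (cases "(0 \<le> s - t * k \<and> s - t * k \<le> 1) \<or> (0 \<le> s + (1 - t) * k \<and> s + (1 - t) * k \<le> 1)")
    case True
    then show ?thesis using c d seg by blast
  next
    case False
    have "a = c + of_real ((t * k - s) / k) * (d - c)"
    proof -
      have "of_real ((t * k - s) / k) * (d - c) = of_real ((t * k - s) / k * k) * (b - a)"
        unfolding k by simp
      also have "\<dots> = of_real (t * k - s) * (b - a)"
        using k0 by simp
      finally have "c + of_real ((t * k - s) / k) * (d - c) =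
          a + of_real (s - t * k) * (b - a) + of_real (t * k - s) * (b - a)"
        using c by simp
      then show ?thesis by (simp add: algebra_simps)
    qed
    moreover have "0 \<le> (t * k - s) / k \<and> (t * k - s) / k \<le> 1"
    proof (cases "k > 0")
      case True
      then have "t * k > 0" "(1 - t) * k > 0" using st by simp_all
      with False st' have "t * k - s > 0" "s + (1 - t) * k > 1" by linarith+
      then show ?thesis using True st' by (simp add: divide_simps algebra_simps)
    next
      case neg: False
      then have "k < 0" using k0 by simp
      then have "t * k < 0" "(1 - t) * k < 0" using st by (simp_all add: mult_pos_neg)
      with False st' have "s - t * k > 1" "s + (1 - t) * k < 0" by linarith+
      then show ?thesis using \<open>k < 0\<close> st' by (simp add: divide_simps algebra_simps)
    qed
    ultimately show ?thesis using seg by blast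
  qed
qed

lemma pair_graph_arcD:
  assumes "pair_graph G" "(u, v) \<in> parcs G"
  shows "u \<in> pverts G \<and> v \<in> pverts G \<and> u \<noteq> v"
proof -
  interpret pair_graph G by fact
  show ?thesis
    using assms(2) in_arcsD1 in_arcsD2 pair_no_loops by fastforce
qed

text \<open>Any unwanted contact of two straight edges, be it an overlap, a touching point or a
  second common point of edges at one vertex, puts an endpoint of one edge on the other. Hypothesis
  \<open>off\<close> excludes this, and what remains is a crossing with nonzero cross
  product.\<close>

lemma straight_is_drawing:
  assumes inj: "inj_on p (pverts G)" and G: "pair_graph G"
    and off: "\<And>u v w. (u, v) \<in> parcs G \<Longrightarrow> w \<in> pverts G \<Longrightarrow> p w \<in> closed_segment (p u) (p v) \<Longrightarrow> w = u \<or> w = v"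
  shows "is_drawing G (straight_drawing p)"
proof -
  note V = pair_graph_arcD[OF G]
  have ne: "p u \<noteq> p v" if "(u, v) \<in> parcs G" for u v
    using V[OF that] inj by (auto dest: inj_onD)
  have star: "closed_segment (p u) (p v) \<inter> closed_segment (p u) (p w) = {p u}"
    if uv: "(u, v) \<in> parcs G" and uw: "(u, w) \<in> parcs G" and vw: "v \<noteq> w" for u v w
  proof -
    have aux: False if "(u, v) \<in> parcs G" "(u, w) \<in> parcs G" "v \<noteq> w"
      "s > 0" "s \<le> t" "t \<le> 1" "p u + s *\<^sub>R (p v - p u) = p u + t *\<^sub>R (p w - p u)" for v w s t
    proof -
      have "p w = p u + (s / t) *\<^sub>R (p v - p u)"
        using that(4,5) arg_cong[OF that(7), of "\<lambda>z. (1/t) *\<^sub>R (z - p u)"] by (simp add: algebra_simps)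
      then have "p w \<in> closed_segment (p u) (p v)"
        unfolding in_segment using that(4,5) by (intro exI[of _ "s / t"]) (auto simp: algebra_simps)
      then show False using off[OF that(1)] V[OF that(2)] that(3) by blast
    qed
    show ?thesis
    proof (intro equalityI subsetI)
      fix y assume "y \<in> closed_segment (p u) (p v) \<inter> closed_segment (p u) (p w)"
      then obtain s t where st: "0 \<le> s" "s \<le> 1" "0 \<le> t" "t \<le> 1"
        "y = p u + s *\<^sub>R (p v - p u)" "y = p u + t *\<^sub>R (p w - p u)"
        unfolding closed_segment_image_interval by (auto simp: algebra_simps)
      then consider "s = 0" | "t = 0" | "s > 0" "s \<le> t" | "t > 0" "t \<le> s" by linarith
      then show "y \<in> {p u}"
        using st aux[OF uv uw vw, of s t] aux[OF uw uv vw[symmetric], of t s] by cases auto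
    qed auto
  qed
  have cross: "crosses_at (linepath (p a) (p b)) s (linepath (p c) (p d)) t \<or>
      crosses_at (linepath (p c) (p d)) t (linepath (p a) (p b)) s"
    if e: "(a, b) \<in> parcs G" and f: "(c, d) \<in> parcs G" and dis: "{a, b} \<inter> {c, d} = {}"
      and st: "s \<in> {0..1}" "t \<in> {0..1}" and eq: "linepath (p a) (p b) s = linepath (p c) (p d) t" for a b c d s t
  proof -
    have nin: "p a \<notin> closed_segment (p c) (p d)" "p b \<notin> closed_segment (p c) (p d)"
      "p c \<notin> closed_segment (p a) (p b)" "p d \<notin> closed_segment (p a) (p b)"
      using off[OF e] off[OF f] V[OF e] V[OF f] dis by blast+
    have "linepath (p a) (p b) s \<in> closed_segment (p c) (p d)"
      "linepath (p c) (p d) t \<in> closed_segment (p a) (p b)"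
      using st eq linepath_in_path[of t "p c" "p d"] linepath_in_path[of s "p a" "p b"] by auto
    then have "s \<noteq> 0" "s \<noteq> 1" "t \<noteq> 0" "t \<noteq> 1"
      using nin by (auto simp: linepath_0' linepath_1')
    with st have st': "s \<in> {0<..<1}" "t \<in> {0<..<1}" by auto
    have "Im (cnj (p b - p a) * (p d - p c)) \<noteq> 0"
      using collinear_segments_overlap[OF st' eq] nin ne e f by blast
    then consider "Im (cnj (p b - p a) * (p d - p c)) > 0" | "Im (cnj (p d - p c) * (p b - p a)) > 0"
      by (fastforce simp: algebra_simps)
    then show ?thesis
      using crosses_at_linepath st' eq by (metis (no_types))
  qed
  show ?thesis
    unfolding is_drawing_def
  proof (intro conjI)
    show "\<forall>(u, v)\<in>parcs G. arc (curve (straight_drawing p) (u, v)) \<and>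
        pathstart (curve (straight_drawing p) (u, v)) = pos (straight_drawing p) u \<and>
        pathfinish (curve (straight_drawing p) (u, v)) = pos (straight_drawing p) v \<and>
        curve (straight_drawing p) (v, u) = reversepath (curve (straight_drawing p) (u, v)) \<and>
        (\<forall>w\<in>pverts G. pos (straight_drawing p) w \<in> path_image (curve (straight_drawing p) (u, v)) \<longrightarrow>
          w = u \<or> w = v)"
      using ne off by (simp add: Ball_def split_paired_All arc_linepath)
    show "\<forall>u v w. (u, v) \<in> parcs G \<and> (u, w) \<in> parcs G \<and> v \<noteq> w \<longrightarrow>
        path_image (curve (straight_drawing p) (u, v)) \<inter> path_image (curve (straight_drawing p) (u, w)) =
        {pos (straight_drawing p) u}"
      using star by simp
    show "\<forall>e\<in>parcs G. \<forall>f\<in>parcs G. {fst e, snd e} \<inter> {fst f, snd f} = {} \<longrightarrow>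
        (\<forall>s\<in>{0..1}. \<forall>t\<in>{0..1}. curve (straight_drawing p) e s = curve (straight_drawing p) f t \<longrightarrow>
           crosses_at (curve (straight_drawing p) e) s (curve (straight_drawing p) f) t \<or>
           crosses_at (curve (straight_drawing p) f) t (curve (straight_drawing p) e) s)"
      using cross by (simp only: Ball_def split_paired_All fst_conv snd_conv straight_drawing_simps) blast
  qed (simp add: inj)
qed

lemma convex_complement_outer_face:
  assumes "skeleton G D \<subseteq> C" "convex C"
  shows "- C \<subseteq> outer_face G D"
  unfolding outer_face_def using outside_subset_convex assms by blast

section \<open>The counterexample\<close>

text \<open>
  The vertices are numbered along a Hamiltonian cycle.  Their positions are
  \<^verbatim>\<open>
    0 1 5 4
    7 6 2 3
  \<close>
\<close>

definition ladder_edges :: "(nat \<times> nat) list" where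
  "ladder_edges =
     [(0, 1), (1, 2), (2, 3), (3, 4), (4, 5), (5, 6), (6, 7), (7, 0),
      (1, 6), (0, 6), (7, 1), (5, 2), (5, 3), (2, 4)]"

definition ladder :: "nat pair_pre_digraph" where
  "ladder = \<lparr>pverts = {0, 1, 2, 3, 4, 5, 6, 7},
     parcs = set ladder_edges \<union> (set ladder_edges)\<inverse>\<rparr>"

definition grid :: "nat \<Rightarrow> complex" where
  "grid i = [Complex 0 1, Complex 1 1, Complex 2 0, Complex 3 0,
             Complex 3 1, Complex 2 1, Complex 1 0, Complex 0 0] ! i"

section \<open>Degree and connectivity of the ladder\<close>

lemma sym_ladder: "sym (parcs ladder)"
  by (auto simp: sym_def ladder_def)

lemma ladder_pair_graph: "pair_graph ladder"
proof
  show "symmetric (with_proj ladder)"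
    using sym_ladder by (simp add: symmetric_def)
qed (auto simp: ladder_def ladder_edges_def)

lemma ladder_max_degree: "max_degree_le 4 ladder"
proof -
  define es where "es = ladder_edges @ map prod.swap ladder_edges"
  have "set es = parcs ladder"
    unfolding es_def ladder_def by force
  then have "out_arcs (with_proj ladder) v = set (filter (\<lambda>e. fst e = v) es)" for v
    by (auto simp: out_arcs_def)
  then have *: "out_degree (with_proj ladder) v \<le> length (filter (\<lambda>e. fst e = v) es)" for v
    unfolding out_degree_def by (metis card_length)
  have "length (filter (\<lambda>e. fst e = v) es) \<le> 4" if "v \<in> pverts ladder" for v
    using that by (auto simp: es_def ladder_def ladder_edges_def)
  with * show ?thesis
    unfolding max_degree_le_def by (meson le_trans)
qed

lemma successively_reachable:
  assumes "successively (\<lambda>x y. (x, y) \<in> r) xs" "set xs \<subseteq> F" "u \<in> set xs"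
  shows "(hd xs, u) \<in> rtrancl_on F (r\<^sup>s) \<and> (u, hd xs) \<in> rtrancl_on F (r\<^sup>s)"
  using assms
proof (induction xs rule: induct_list012)
  case (3 x y zs)
  have "(x, y) \<in> r\<^sup>s" "(y, x) \<in> r\<^sup>s" "x \<in> F" "y \<in> F"
    using 3(3,4) by (auto simp: symcl_def)
  then show ?case
    using 3 by (auto intro: rtrancl_on_into_rtrancl_on converse_rtrancl_on_into_rtrancl_on)
qed auto

lemma successively_connected:
  assumes "xs \<noteq> []" "set xs = verts H" "successively (\<lambda>x y. (x, y) \<in> arcs_ends H) xs"
  shows "Digraph_Component.connected H"
  unfolding connected_conv using assms(1,2) successively_reachable[OF assms(3), of "verts H"]
  by (auto intro: rtrancl_on_trans)

lemma arcs_ends_del_vert_with_proj: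
  "arcs_ends (pre_digraph.del_vert (with_proj G) v) = {(x, y) \<in> parcs G. x \<noteq> v \<and> y \<noteq> v}"
  by (auto simp: arcs_ends_conv pre_digraph.del_vert_def image_iff)

lemma ladder_biconnected: "biconnected ladder"
proof -
  have conn: "Digraph_Component.connected (with_proj ladder)"
    by (rule successively_connected[of "[0, 1, 2, 3, 4, 5, 6, 7]"])
      (auto simp: ladder_def ladder_edges_def)
  have "Digraph_Component.connected (pre_digraph.del_vert (with_proj ladder) v)" if "v \<in> pverts ladder" for v
  \<comment> \<open>Removing \<open>v\<close> from the Hamiltonian cycle leaves the path that starts
    after \<open>v\<close> and wraps around to end before it.\<close>
  proof (rule successively_connected[of "[Suc v..<8] @ [0..<v]"])
    have v: "v \<in> {0, 1, 2, 3, 4, 5, 6, 7}"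
      using that by (simp add: ladder_def)
    then show "[Suc v..<8] @ [0..<v] \<noteq> []"
      by auto
    from v show "set ([Suc v..<8] @ [0..<v]) = verts (pre_digraph.del_vert (with_proj ladder) v)"
      by (elim insertE emptyE; simp add: pre_digraph.del_vert_def ladder_def eval_nat_numeral; auto)
    from v show "successively (\<lambda>x y. (x, y) \<in> arcs_ends (pre_digraph.del_vert (with_proj ladder) v))
        ([Suc v..<8] @ [0..<v])"
      unfolding arcs_ends_del_vert_with_proj
      by (elim insertE emptyE) (simp_all add: ladder_def ladder_edges_def eval_nat_numeral)
  qed
  then show ?thesis
    unfolding biconnected_def using conn by (simp add: ladder_def)
qed

section \<open>The straight-line drawing of the ladder is outer-1-planar\<close>

lemma grid_simps:
  "grid 0 = Complex 0 1" "grid (Suc 0) = Complex 1 1" "grid 2 = Complex 2 0" "grid 3 = Complex 3 0"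
  "grid 4 = Complex 3 1" "grid 5 = Complex 2 1" "grid 6 = Complex 1 0" "grid 7 = Complex 0 0"
  by (simp_all add: grid_def)

text \<open>Some coordinate of \<open>q - p\<close> is 1 or -1 unless \<open>p = q\<close>, so a
  lattice point on the segment has an integral parameter. Every edge of the ladder is such a side or
  diagonal of a unit square.\<close>

lemma lattice_unit_segment:
  fixes p q z :: complex
  assumes z: "z \<in> closed_segment p q"
    and int: "Re p \<in> \<int>" "Im p \<in> \<int>" "Re z \<in> \<int>" "Im z \<in> \<int>"
    and unit: "Re (q - p) \<in> {-1,0,1}" "Im (q - p) \<in> {-1,0,1}"
  shows "z = p \<or> z = q"
proof -
  obtain u where u: "0 \<le> u" "u \<le> 1" "z = p + u *\<^sub>R (q - p)"
    using z unfolding in_segment by (auto simp: algebra_simps)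
  have unit_Ints: "u = 0 \<or> u = 1" if "u \<in> \<int>"
    using that u by (auto elim!: Ints_cases)
  have "Re z - Re p = u * Re (q - p)" "Im z - Im p = u * Im (q - p)"
    using u by simp_all
  then have "u * Re (q - p) \<in> \<int>" "u * Im (q - p) \<in> \<int>"
    using int Ints_diff by metis+
  then have "u \<in> \<int> \<or> q - p = 0"
    using unit by (auto simp: complex_eq_iff)
  then show ?thesis
    using unit_Ints u by auto
qed

lemma inj_grid: "inj_on grid (pverts ladder)"
  by (simp add: ladder_def grid_simps)

lemma grid_Ints: "v \<in> pverts ladder \<Longrightarrow> Re (grid v) \<in> \<int> \<and> Im (grid v) \<in> \<int>"
  by (auto simp: ladder_def grid_simps)

lemma ladder_drawing: "is_drawing ladder (straight_drawing grid)"
proof (rule straight_is_drawing[OF inj_grid ladder_pair_graph])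
  fix u v w assume uv: "(u, v) \<in> parcs ladder" and w: "w \<in> pverts ladder"
    and seg: "grid w \<in> closed_segment (grid u) (grid v)"
  note V = pair_graph_arcD[OF ladder_pair_graph uv]
  have "Re (grid v - grid u) \<in> {-1,0,1} \<and> Im (grid v - grid u) \<in> {-1,0,1}"
    using uv by (auto simp: ladder_def ladder_edges_def grid_simps)
  then have "grid w = grid u \<or> grid w = grid v"
    using V w seg grid_Ints by (intro lattice_unit_segment) auto
  then show "w = u \<or> w = v"
    using inj_grid V w by (auto dest: inj_onD)
qed

text \<open>Edges are taken in the orientation listed in \<open>ladder_edges\<close>. The last
  branch serves \<open>(2, 4)\<close> and is a default value for uncrossed edges; 1-planarity only
  asks for at most one possible partner at one possible parameter.\<close>

definition partner :: "nat \<times> nat \<Rightarrow> nat \<times> nat" where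
  "partner e = (if e = (0, 6) then (7, 1) else if e = (7, 1) then (0, 6)
     else if e = (1, 2) then (5, 6) else if e = (5, 6) then (1, 2)
     else if e = (5, 3) then (2, 4) else (5, 3))"

lemma ladder_edges_meet:
  assumes ef: "(u, v) \<in> set ladder_edges" "(x, y) \<in> set ladder_edges" and st: "0 < s" "s < 1" "0 \<le> t" "t \<le> 1"
    and eq: "linepath (grid u) (grid v) s = linepath (grid x) (grid y) t"
  shows "(x, y) = (u, v) \<or> s = 1/2 \<and> (x, y) = partner (u, v)"
proof -
  have Re_linepath: "Re (linepath p q r) = Re p + r * (Re q - Re p)" 
    and Im_linepath: "Im (linepath p q r) = Im p + r * (Im q - Im p)" for p q r
    by (simp_all add: linepath_def algebra_simps)
  have "Re (grid u) + s * (Re (grid v) - Re (grid u)) = Re (grid x) + t * (Re (grid y) - Re (grid x))"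
    "Im (grid u) + s * (Im (grid v) - Im (grid u)) = Im (grid x) + t * (Im (grid y) - Im (grid x))"
    using arg_cong[OF eq, of Re] arg_cong[OF eq, of Im] unfolding Re_linepath Im_linepath by simp_all
  with ef st show ?thesis
    unfolding ladder_edges_def list.set
    apply (elim insertE emptyE)
    apply (simp_all add: grid_simps partner_def)
    done
qed

lemma ladder_arcs_meet:
  assumes e: "e \<in> parcs ladder" and f: "f \<in> parcs ladder" and ne: "f \<notin> {e, prod.swap e}"
    and s: "s \<in> {0<..<1}"
    and meet: "curve (straight_drawing grid) e s \<in> path_image (curve (straight_drawing grid) f)"
  obtains g where "g \<in> set ladder_edges" "g \<in> {e, prod.swap e}" "partner g \<in> {f, prod.swap f}" "s = 1/2"
proof -
  have orient: "\<exists>u v. (u, v) \<in> set ladder_edges \<and> (a = (u, v) \<or> a = (v, u))" if "a \<in> parcs ladder" for a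
    using that by (cases a) (auto simp: ladder_def)
  obtain u v where uv: "(u, v) \<in> set ladder_edges" "e = (u, v) \<or> e = (v, u)"
    using orient[OF e] by blast
  obtain x y where xy: "(x, y) \<in> set ladder_edges" "f = (x, y) \<or> f = (y, x)"
    using orient[OF f] by blast
  have rev: "linepath p q r = linepath q p (1 - r)" for p q :: complex and r
    by (simp add: linepath_def algebra_simps)
  \<comment> \<open>Reversing an edge replaces its parameter by \<open>1 - s\<close>, which leaves
    the crossing parameter 1/2 fixed.\<close>
  define r where "r = (if e = (u, v) then s else 1 - s)"
  have r: "0 < r" "r < 1" "curve (straight_drawing grid) e s = linepath (grid u) (grid v) r"
    using s uv(2) rev by (auto simp: r_def)
  have "path_image (curve (straight_drawing grid) f) = closed_segment (grid x) (grid y)"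
    using xy(2) by (auto simp: closed_segment_commute)
  with meet r(3) obtain t where "0 \<le> t" "t \<le> 1" "linepath (grid u) (grid v) r = linepath (grid x) (grid y) t"
    unfolding linepath_image_01[symmetric] by auto
  then have "(x, y) = (u, v) \<or> r = 1/2 \<and> (x, y) = partner (u, v)"
    using ladder_edges_meet[OF uv(1) xy(1) r(1,2)] by blast
  moreover have "(x, y) \<noteq> (u, v)"
    using ne uv(2) xy(2) by auto
  ultimately have "r = 1/2" "partner (u, v) = (x, y)"
    by auto
  then show thesis
    using uv xy by (intro that[of "(u, v)"]) (auto simp: r_def split: if_splits)
qed

lemma ladder_one_planar: "one_planar ladder (straight_drawing grid)"
proof -
  have orient: "prod.swap g \<notin> set ladder_edges" if "g \<in> set ladder_edges" for g
    using that by (auto simp: ladder_edges_def)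
  have "s = s' \<and> f' \<in> {f, prod.swap f}"
    if H: "e \<in> parcs ladder" "f \<in> parcs ladder" "f' \<in> parcs ladder" "s \<in> {0<..<1}" "s' \<in> {0<..<1}"
      "f \<notin> {e, prod.swap e}" "f' \<notin> {e, prod.swap e}"
      "curve (straight_drawing grid) e s \<in> path_image (curve (straight_drawing grid) f)"
      "curve (straight_drawing grid) e s' \<in> path_image (curve (straight_drawing grid) f')" for e f f' s s'
  proof -
    obtain g where g: "g \<in> set ladder_edges" "g \<in> {e, prod.swap e}" "partner g \<in> {f, prod.swap f}" "s = 1/2"
      using ladder_arcs_meet[OF H(1,2,6,4,8)] by blast
    obtain g' where g': "g' \<in> set ladder_edges" "g' \<in> {e, prod.swap e}" "partner g' \<in> {f', prod.swap f'}"
      "s' = 1/2"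
      using ladder_arcs_meet[OF H(1,3,7,5,9)] by blast
    have "g' = g"
      using orient[OF g(1)] g(2) g'(1,2) by auto
    then show ?thesis
      using g(3,4) g'(3,4) by (metis insert_iff singletonD swap_swap)
  qed
  then show ?thesis
    unfolding one_planar_def using ladder_drawing by blast
qed

lemma ladder_outer_one_planar: "outer_one_planar ladder (straight_drawing grid)"
proof -
  \<comment> \<open>All vertices lie on the two boundary lines of this strip, so each is a limit of
    points straight above or below it, which belong to the outer face.\<close>
  define C :: "complex set" where "C = {z. 0 \<le> Im z} \<inter> {z. Im z \<le> 1}"
  have C: "convex C"
    unfolding C_def by (intro convex_Int convex_halfspace_Im_ge convex_halfspace_Im_le)
  have gridC: "grid v \<in> C \<and> Im (grid v) \<in> {0, 1}" if "v \<in> pverts ladder" for v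
    using that by (auto simp: ladder_def grid_simps C_def)
  have "path_image (curve (straight_drawing grid) e) \<subseteq> C" if "e \<in> parcs ladder" for e
    using that gridC pair_graph_arcD[OF ladder_pair_graph]
    by (cases e) (simp add: closed_segment_subset[OF _ _ C])
  then have "skeleton ladder (straight_drawing grid) \<subseteq> C"
    unfolding skeleton_def using gridC by auto
  then have out: "- C \<subseteq> outer_face ladder (straight_drawing grid)"
    using C by (rule convex_complement_outer_face)
  have "grid v \<in> closure (- C)" if "v \<in> pverts ladder" for v
    unfolding closure_approachable
  proof (intro allI impI)
    fix r :: real assume "0 < r"
    define y where "y = grid v + (if Im (grid v) = 1 then Complex 0 (r / 2) else Complex 0 (- r / 2))"
    have "y \<in> - C" "dist y (grid v) < r"
      using gridC[OF that] \<open>0 < r\<close> by (auto simp: y_def C_def dist_norm complex_norm)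
    then show "\<exists>y\<in>- C. dist y (grid v) < r"
      by blast
  qed
  then show ?thesis
    unfolding outer_one_planar_def using ladder_one_planar closure_mono[OF out] by auto
qed

text \<open>The first six triples are the rotations required by \<open>k4_block\<close> for the left
  square, the other six their images under the half turn of the picture, which swaps 0 with 3, 1
  with 2, 6 with 5 and 7 with 4.\<close>

lemma ladder_rotations:
  "(v, x, y, z) \<in> {(0, 7, 6, 1), (7, 6, 1, 0), (1, 0, 7, 6), (1, 0, 6, 2), (6, 5, 1, 0), (6, 5, 0, 7),
     (3, 4, 5, 2), (4, 5, 2, 3), (2, 3, 4, 5), (2, 3, 5, 1), (5, 6, 2, 3), (5, 6, 3, 4)} \<Longrightarrow>
   rotation (straight_drawing grid) v x y z"
  by (rule straight_rotation) (auto simp: grid_simps)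

text \<open>Since \<open>crosses\<close> is directed, each pair is oriented so that the second edge
  passes the first from right to left. All crossings are at the midpoints.\<close>

lemma ladder_crosses:
  assumes "((u, v), (x, y)) \<in> {((0, 6), (7, 1)), ((1, 2), (6, 5)), ((3, 5), (4, 2))}"
  shows "crosses (straight_drawing grid) (u, v) (x, y)"
  unfolding crosses_def straight_drawing_simps
  by (intro exI[of _ "1/2"], rule crosses_at_linepath)
     (use assms in \<open>auto simp: grid_simps linepath_def complex_eq_iff\<close>)

section \<open>Contradiction from a layout with at most one bend per edge\<close>

lemma ladder_no_OC2_layout:
  assumes OC: "OC_layout 2 ladder L" and emb: "same_embedding ladder (straight_drawing grid) L"
  shows False
proof -
  have draw: "is_drawing ladder L"
    and oc: "\<And>e. e \<in> parcs ladder \<Longrightarrow> \<exists>k\<le>2. orthogonal_curve k (curve L e)"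
    using OC unfolding OC_layout_def orthogonal_layout_def by auto
  have arc: "arc (curve L (u, v))" and start: "curve L (u, v) 0 = pos L u" and fin: "curve L (u, v) 1 = pos L v"
    and rev: "curve L (v, u) = reversepath (curve L (u, v))" if "(u, v) \<in> parcs ladder" for u v
    using draw that unfolding is_drawing_def pathstart_def pathfinish_def by fast+
  have "\<exists>b d t. elbow (curve L (u, v)) b d t" if "(u, v) \<in> parcs ladder" for u v
    using elbow_exists arc oc that by metis
  then obtain bp dr tn where elb: "\<And>u v. (u, v) \<in> parcs ladder \<Longrightarrow> elbow (curve L (u, v)) (bp u v) (dr u v) (tn u v)"
    by metis
  have swap: "(v, u) \<in> parcs ladder" if "(u, v) \<in> parcs ladder" for u v
    using sym_ladder that by (auto dest: symD)
  have dep: "path (curve L (u, v))" "departs (curve L (u, v)) (dr u v)" "axial (dr u v)" "tn u v \<in> {-1,0,1}"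
    if "(u, v) \<in> parcs ladder" for u v
    using elbow_departs[OF elb[OF that]] elb[OF that] arc[OF that] unfolding elbow_def
    by (auto intro: arc_imp_path)
  \<comment> \<open>The data of the two arcs of an edge were chosen independently. They agree
    because a curve has only one axis direction of departure.\<close>
  have dr_swap: "dr v u = - (dr u v * \<i> powi tn u v)" if "(u, v) \<in> parcs ladder" for u v
  proof (rule departs_unique)
    show "departs (curve L (v, u)) (- (dr u v * \<i> powi tn u v))"
      using elbow_departs_end[OF elb[OF that]] unfolding rev[OF that] .
    show "axial (- (dr u v * \<i> powi tn u v))"
      by (intro axial_mult axial_times_powi dep that)
  qed (use dep[OF swap[OF that]] in auto)
  have edge: "axial_edge (pos L) dr tn u v" if "(u, v) \<in> parcs ladder" for u v
    using elbow_route[OF elb[OF that]] dep[OF that] dr_swap[OF that] start[OF that] fin[OF that]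
    unfolding axial_edge_def by metis
  have emb_rot: "rotation (straight_drawing grid) v x y z \<longleftrightarrow> rotation L v x y z"
    if "(v, x) \<in> parcs ladder" "(v, y) \<in> parcs ladder" "(v, z) \<in> parcs ladder" for v x y z
    using emb[unfolded same_embedding_def, THEN conjunct1] that by simp
  have emb_cross: "crosses (straight_drawing grid) e f \<longleftrightarrow> crosses L e f"
    if "e \<in> parcs ladder" "f \<in> parcs ladder" for e f
    using emb[unfolded same_embedding_def, THEN conjunct2, THEN conjunct1] that by simp
  have rot: "dir_less (dr v x) (dr v y) (dr v z)"
    if "(v, x, y, z) \<in> {(0, 7, 6, 1), (7, 6, 1, 0), (1, 0, 7, 6), (1, 0, 6, 2), (6, 5, 1, 0), (6, 5, 0, 7),
     (3, 4, 5, 2), (4, 5, 2, 3), (2, 3, 4, 5), (2, 3, 5, 1), (5, 6, 2, 3), (5, 6, 3, 4)}" for v x y z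
  proof -
    have arcs: "(v, x) \<in> parcs ladder" "(v, y) \<in> parcs ladder" "(v, z) \<in> parcs ladder"
      using that by (elim insertE emptyE; simp add: ladder_def ladder_edges_def)+
    have "rotation L v x y z"
      using ladder_rotations[OF that] emb_rot[OF arcs] by simp
    then show ?thesis
      unfolding rotation_def
      ccw_departs[OF arcs[THEN dep(1)] arcs[THEN dep(2)] arcs[THEN dep(3), THEN axial_nonzero]] .
  qed
  have cross: "\<exists>p \<delta> t1 t2 t3 t4. (t1 = 0 \<or> t2 = 0) \<and>
      arrives (pos L u) (dr u v) t1 p \<delta> \<and> arrives (pos L v) (dr v u) t2 p (- \<delta>) \<and>
      arrives (pos L x) (dr x y) t3 p (\<i> * \<delta>) \<and> arrives (pos L y) (dr y x) t4 p (- (\<i> * \<delta>))"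
    if "((u, v), (x, y)) \<in> {((0, 6), (7, 1)), ((1, 2), (6, 5)), ((3, 5), (4, 2))}" for u v x y
  proof -
    have arcs: "(u, v) \<in> parcs ladder" "(x, y) \<in> parcs ladder"
      using that by (elim insertE emptyE; simp add: ladder_def ladder_edges_def)+
    have "crosses L (u, v) (x, y)"
      using ladder_crosses[OF that] emb_cross[OF arcs] by simp
    then obtain s t where st: "crosses_at (curve L (u, v)) s (curve L (x, y)) t"
      unfolding crosses_def by blast
    then have meet: "curve L (u, v) s = curve L (x, y) t"
      unfolding crosses_at_def by blast
    obtain \<delta> t1 t2 t3 t4 where "halves (curve L (u, v)) s \<delta> (dr u v) (dr v u) t1 t2"
      "halves (curve L (x, y)) t (\<i> * \<delta>) (dr x y) (dr y x) t3 t4"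
      by (rule crossing_halves[OF arc[OF arcs(1)] elb[OF arcs(1)] arc[OF arcs(2)] elb[OF arcs(2)] st,
        folded dr_swap[OF arcs(1)] dr_swap[OF arcs(2)]])
    then show ?thesis
      unfolding halves_def start[OF arcs(1)] start[OF arcs(2)] fin[OF arcs(1)] fin[OF arcs(2)] meet
      by blast
  qed
  obtain p \<delta> l1 l2 l3 l4 where left:
    "arrives (pos L 0) (dr 0 6) l1 p \<delta>" "arrives (pos L 6) (dr 6 0) l2 p (- \<delta>)"
    "arrives (pos L 7) (dr 7 1) l3 p (\<i> * \<delta>)" "arrives (pos L 1) (dr 1 7) l4 p (- (\<i> * \<delta>))"
    using cross[of 0 6 7 1] by simp blast
  \<comment> \<open>The last direction is written with \<open>- \<epsilon>\<close> because the right
    square sees this crossing after a half turn, with \<open>- \<epsilon>\<close> in the role of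
    \<open>\<epsilon>\<close>.\<close>
  obtain q \<epsilon> m1 m2 m3 m4 where m: "m1 = 0 \<or> m2 = 0" and mid:
    "arrives (pos L 1) (dr 1 2) m1 q \<epsilon>" "arrives (pos L 2) (dr 2 1) m2 q (- \<epsilon>)"
    "arrives (pos L 6) (dr 6 5) m3 q (\<i> * \<epsilon>)" "arrives (pos L 5) (dr 5 6) m4 q (\<i> * - \<epsilon>)"
    using cross[of 1 2 6 5] by simp blast
  obtain r \<zeta> n1 n2 n3 n4 where right:
    "arrives (pos L 3) (dr 3 5) n1 r \<zeta>" "arrives (pos L 5) (dr 5 3) n2 r (- \<zeta>)"
    "arrives (pos L 4) (dr 4 2) n3 r (\<i> * \<zeta>)" "arrives (pos L 2) (dr 2 4) n4 r (- (\<i> * \<zeta>))"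
    using cross[of 3 5 4 2] by simp blast
  have edges: "\<forall>(u, v)\<in>S. axial_edge (pos L) dr tn u v" if "S \<subseteq> parcs ladder" for S
    using edge that by blast
  \<comment> \<open>Here \<open>m1\<close> and \<open>m2\<close> are the bends of the two halves of
    the one diagonal from 1 to 2; the left square settles the half at 1 and the right square the
    half at 2.\<close>
  have "m1 = - 1"
    by (rule k4_block[where a = 0 and b = 1 and c = 6 and a' = 7, OF edges left mid(1,3)]; (rule rot)?)
       (simp_all add: ladder_def ladder_edges_def)
  moreover have "m2 = - 1"
    by (rule k4_block[where a = 3 and b = 2 and c = 5 and a' = 4, OF edges right mid(2,4)]; (rule rot)?)
       (simp_all add: ladder_def ladder_edges_def)
  ultimately show False
    using m by simp
qed

theorem theorem3:
  shows "\<exists>(G :: nat pair_pre_digraph) (D :: nat drawing).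
           pair_graph G \<and> biconnected G \<and> max_degree_le 4 G \<and> outer_one_planar G D \<and>
           \<not> (\<exists>L. OC_layout 2 G L \<and> same_embedding G D L)"
  using ladder_pair_graph ladder_biconnected ladder_max_degree ladder_outer_one_planar ladder_no_OC2_layout
  by blast

end
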